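(* Let $k\ge1$ be an integer, and for nonnegative integers $n_1,\dots,n_k,r,j$ put $M_i=n_i+n_{i+1}+\cdots+n_k+r+j$ for $1\le i\le k$. Then (as formal power series in $q$, and hence also as analytic functions for $|q|<1$) $$1+\sum_{\substack{n_1,\dots,n_k,r,j\ge0\\ (n_1,\dots,n_k,r,j)\ne(0,\dots,0)}} \frac{q^{3(M_1^2+\cdots+M_k^2)+\frac32r^2-\frac52r-j}\,(q^3;q^3)_{2j+r-1}\,(1+q^{2r+2j})\,(1-q^{6r+6j})}{(q^3;q^3)_{n_1}\cdots(q^3;q^3)_{n_k}\,(q^3;q^3)_r\,(q^3;q^3)_j\,(-1;q^3)_{j+1}\,(q^3;q^3)_{n_k+2r+2j}}=\frac{(-q^{3k-1},-q^{3k+1},q^{6k};q^{6k})_\infty}{(q^3;q^3)_\infty},$$ where in the terms with $r=j=0$ the product $(q^3;q^3)_{2j+r-1}(1-q^{6r+6j})$ is interpreted as $1$.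
   Context: Notation: $(A;q)_0=1$, $(A;q)_n=(1-A)(1-Aq)\cdots(1-Aq^{n-1})$ for $n\ge 1$, $(A;q)_\infty=\prod_{i=0}^\infty(1-Aq^i)$, and $(A_1,\dots,A_r;q)_s=(A_1;q)_s\cdots(A_r;q)_s$. *)

theory Defs
  imports "HOL-Complex_Analysis.Complex_Analysis"
begin

(* Everything is stated over a type class that covers both readings of the base q:
   a complex number (with norm q < 1), and the indeterminate fps_X in complex fps, where
   limits, infinite sums and infinite products refer to the X-adic topology. *)

definition qpoch :: "'a::comm_ring_1 \<Rightarrow> 'a \<Rightarrow> nat \<Rightarrow> 'a" where
  "qpoch A q n = (\<Prod>i<n. 1 - A * q ^ i)"

definition qpoch_inf :: "'a::{comm_ring_1,t2_space} \<Rightarrow> 'a \<Rightarrow> 'a" where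
  "qpoch_inf A q = (\<Prod>i. 1 - A * q ^ i)"

definition Mpart :: "nat \<Rightarrow> (nat \<Rightarrow> nat) \<Rightarrow> nat \<Rightarrow> nat \<Rightarrow> nat \<Rightarrow> nat" where
  "Mpart k n r j i = (\<Sum>l=i..k. n l) + r + j"

(* The exponent as an integer; r * (3 * r - 5) is always even, so div is exact. *)
definition qexponent_int :: "nat \<Rightarrow> (nat \<Rightarrow> nat) \<Rightarrow> nat \<Rightarrow> nat \<Rightarrow> int" where
  "qexponent_int k n r j =
     3 * (\<Sum>i=1..k. (int (Mpart k n r j i))\<^sup>2) + (3 * (int r)\<^sup>2 - 5 * int r) div 2 - int j"

(* The cut-off in nat never takes effect for k \<ge> 1: see real_qexponent below. *)
definition qexponent :: "nat \<Rightarrow> (nat \<Rightarrow> nat) \<Rightarrow> nat \<Rightarrow> nat \<Rightarrow> nat" where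
  "qexponent k n r j = nat (qexponent_int k n r j)"

lemma qexponent_int_nonneg:
  assumes "k \<ge> 1"
  shows "qexponent_int k n r j \<ge> 0"
proof -
  have sq: "x \<le> x\<^sup>2" if "x \<ge> 0" for x :: int
    using that by (cases "x = 0") (auto simp: power2_eq_square mult_le_cancel_left1)
  have "int r + int j \<le> int (Mpart k n r j 1)"
    by (simp add: Mpart_def sum_nonneg)
  also have "\<dots> \<le> (int (Mpart k n r j 1))\<^sup>2"
    by (rule sq) simp
  also have "\<dots> \<le> (\<Sum>i=1..k. (int (Mpart k n r j i))\<^sup>2)"
    using assms by (intro member_le_sum) auto
  finally have "int r + int j \<le> (\<Sum>i=1..k. (int (Mpart k n r j i))\<^sup>2)" .
  moreover have "-2 * int r \<le> (3 * (int r)\<^sup>2 - 5 * int r) div 2"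
    using sq[of "int r", OF of_nat_0_le_iff] of_nat_0_le_iff[of r] by linarith
  ultimately show ?thesis
    by (simp add: qexponent_int_def)
qed

lemma real_qexponent:
  assumes "k \<ge> 1"
  shows "real (qexponent k n r j) =
    3 * (\<Sum>i=1..k. (real (Mpart k n r j i))\<^sup>2) + 3/2 * (real r)\<^sup>2 - 5/2 * real r - real j"
proof -
  have "even (3 * (int r)\<^sup>2 - 5 * int r)"
    by simp
  then have "real_of_int ((3 * (int r)\<^sup>2 - 5 * int r) div 2) = 3/2 * (real r)\<^sup>2 - 5/2 * real r"
    by (simp add: real_of_int_div field_simps)
  moreover have "real (qexponent k n r j) = real_of_int (qexponent_int k n r j)"
    using qexponent_int_nonneg[OF assms, of n r j] by (simp add: qexponent_def)
  ultimately show ?thesis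
    by (simp add: qexponent_int_def)
qed

(* The if-expression is the convention that (q^3;q^3)_{2j+r-1} (1 - q^{6r+6j}) means 1 when
   r = j = 0; in the other branch 2 * j + r - 1 is not truncated. *)
definition qsummand :: "nat \<Rightarrow> 'a::{comm_ring_1,inverse} \<Rightarrow> (nat \<Rightarrow> nat) \<times> nat \<times> nat \<Rightarrow> 'a" where
  "qsummand k q = (\<lambda>(n, r, j).
     (q ^ qexponent k n r j
        * (if r = 0 \<and> j = 0 then 1
           else qpoch (q ^ 3) (q ^ 3) (2 * j + r - 1) * (1 - q ^ (6 * r + 6 * j)))
        * (1 + q ^ (2 * r + 2 * j)))
     / ((\<Prod>i=1..k. qpoch (q ^ 3) (q ^ 3) (n i))
        * qpoch (q ^ 3) (q ^ 3) r * qpoch (q ^ 3) (q ^ 3) j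
        * qpoch (- 1) (q ^ 3) (j + 1)
        * qpoch (q ^ 3) (q ^ 3) (n k + 2 * r + 2 * j)))"

(* The tuples (n_1,...,n_k,r,j) other than (0,...,0); n is extensional on {1..k}, so that
   each tuple is represented exactly once. *)
definition nonzero_tuples :: "nat \<Rightarrow> ((nat \<Rightarrow> nat) \<times> nat \<times> nat) set" where
  "nonzero_tuples k =
     {(n, r, j). n \<in> {1..k} \<rightarrow>\<^sub>E UNIV \<and> \<not> ((\<forall>i\<in>{1..k}. n i = 0) \<and> r = 0 \<and> j = 0)}"

definition multisum :: "nat \<Rightarrow> 'a::{comm_ring_1,inverse,t2_space} \<Rightarrow> 'a" where
  "multisum k q = 1 + (\<Sum>\<^sub>\<infinity>t\<in>nonzero_tuples k. qsummand k q t)"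

definition product_side :: "nat \<Rightarrow> 'a::{comm_ring_1,inverse,t2_space} \<Rightarrow> 'a" where
  "product_side k q =
     qpoch_inf (- (q ^ (3 * k - 1))) (q ^ (6 * k))
       * qpoch_inf (- (q ^ (3 * k + 1))) (q ^ (6 * k))
       * qpoch_inf (q ^ (6 * k)) (q ^ (6 * k))
     / qpoch_inf (q ^ 3) (q ^ 3)"

end

theory Submission
  imports Defs
begin

text \<open>
  Write \<open>Q = q\<^sup>3\<close>, \<open>(A)\<^sub>n\<close> for \<open>qpoch A Q n\<close>, \<open>(A)\<^sub>\<infinity>\<close> for \<open>qpoch_inf A Q\<close> and \<open>m = r + j\<close>. The multisum is
  evaluated by a Bailey chain, whose ingredients are all special cases of one finite sum,
  \<open>q_Vandermonde\<close>.

  For fixed \<open>r\<close> and \<open>j\<close>, the variables \<open>n\<^sub>1, \<dots>, n\<^sub>k\<close> enter only through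
  \<open>Q\<close> to the power \<open>M\<^sub>1\<^sup>2 + \<dots> + M\<^sub>k\<^sup>2\<close> and the factors \<open>(Q)\<^sub>n\<close> for \<open>n = n\<^sub>1, \<dots>, n\<^sub>k\<close> and
  \<open>n = n\<^sub>k + 2 m\<close> in the denominator. If \<open>n\<^bsub>k-1\<^esub> + n\<^sub>k\<close> is held fixed, the sum over \<open>n\<^sub>k\<close> is
  finite, and it reproduces the summand with \<open>k - 1\<close> in place of \<open>k\<close>, times \<open>Q\<close> to the power
  \<open>m\<^sup>2\<close> (\<open>q_Vandermonde_Durfee\<close>). After \<open>k - 1\<close> such steps a Durfee series is left, and the sum over
  all \<open>n\<^sub>1, \<dots>, n\<^sub>k\<close> is \<open>Q\<close> to the power \<open>k m\<^sup>2\<close>, divided by \<open>(Q)\<^sub>\<infinity>\<close> (\<open>chain_weight_has_sum\<close>).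

  This depends on \<open>r\<close> and \<open>j\<close> only through \<open>m\<close>. The remaining factors, summed over all \<open>r\<close> and \<open>j\<close>
  with \<open>r + j = m\<close>, form a terminating series of the same type (\<open>q_Vandermonde_half\<close>), whose value
  is 1 for \<open>m = 0\<close> and \<open>q\<^sup>m + q\<^bsup>-m\<^esup>\<close> for \<open>m > 0\<close> (\<open>outer_weight_sum\<close>). Hence the multisum,
  multiplied by \<open>(Q)\<^sub>\<infinity>\<close>, is the sum of \<open>q\<close> to the power \<open>3 k m\<^sup>2 + m\<close> over all integers \<open>m\<close>, and the
  Jacobi triple product turns this theta series into the product on the right-hand side.

  The argument divides by powers of \<open>q\<close> and is therefore carried out for complex \<open>q \<noteq> 0\<close> in the unit
  disc, where a bound on the summand, uniform on smaller discs, justifies all rearrangements; \<open>q = 0\<close>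
  follows by continuity. The same uniform bounds show that both sides are analytic. Each partial sum
  or partial product has its formal counterpart as Taylor series at 0; as the convergence is
  uniform near 0 on the analytic side and coefficientwise on the formal side, the formal multisum
  and the formal product are the Taylor series of the two analytic functions, hence equal.
\<close>

section \<open>Shifted factorials and the q-Vandermonde sum\<close>

lemma qpoch_0 [simp]: "qpoch a q 0 = 1"
  by (simp add: qpoch_def)

lemma qpoch_Suc: "qpoch a q (Suc n) = qpoch a q n * (1 - a * q ^ n)"
  by (simp add: qpoch_def)

lemma qpoch_add: "qpoch a q (m + n) = qpoch a q m * qpoch (a * q ^ m) q n"
  by (induction n) (simp_all add: qpoch_Suc power_add mult_ac)

lemma qpoch_Suc_left: "qpoch a q (Suc n) = (1 - a) * qpoch (a * q) q n"
  using qpoch_add[of a q 1 n] by (simp add: qpoch_Suc)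

lemma qpoch_nonzero:
  fixes a q :: "'a::field"
  assumes "\<And>i. a * q ^ i \<noteq> 1"
  shows "qpoch a q n \<noteq> 0"
  using assms by (auto simp: qpoch_def)

lemma Suc_choose_2: "Suc n choose 2 = (n choose 2) + n"
  by (simp add: numeral_2_eq_2)

lemma zero_choose_2 [simp]: "0 choose 2 = 0"
  by (simp add: numeral_2_eq_2)

lemma prod_mult_power: "(\<Prod>i<n. c * q ^ i) = c ^ n * (q::'a::comm_ring_1) ^ (n choose 2)"
  by (induction n) (simp_all add: Suc_choose_2 power_add mult_ac)

text \<open>
  For \<open>b = c / a\<close> the product equals \<open>(- b)\<^sup>j\<close> times the shifted factorial of \<open>a\<close>, so this is the
  classical q-Chu-Vandermonde sum; writing it with \<open>b\<close> and \<open>c\<close> in place of \<open>a\<close>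
  admits the values \<open>b = 0\<close> and \<open>c = 0\<close>, which correspond to the limits \<open>a \<rightarrow> \<infinity>\<close> and \<open>a \<rightarrow> 0\<close>.

  The induction on \<open>n\<close> is the q-Pascal rule in disguise: multiply the sum for \<open>n + 1\<close> by
  \<open>1 - q\<^bsup>n+1\<^esup>\<close> and split
  \<open>1 - q\<^bsup>n+1\<^esup> = (1 - q\<^bsup>n+1-j\<^esup>) + q\<^bsup>n+1-j\<^esup> (1 - q\<^sup>j)\<close> in the summand of index \<open>j\<close>. The first part
  gives the sum for \<open>n\<close>; in the second, an index shift pulls out the factor \<open>(c - b) / (1 - c)\<close>
  and leaves the sum for \<open>n\<close> with \<open>c q\<close> in place of \<open>c\<close>.
\<close>
proposition q_Vandermonde:
  fixes q b c :: "'a::field"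
  assumes q: "\<And>i. q ^ Suc i \<noteq> 1" and c: "\<And>i. c * q ^ i \<noteq> 1"
  shows "(\<Sum>j\<le>n. q ^ (j choose 2) * (\<Prod>i<j. c * q ^ i - b)
            / (qpoch q q j * qpoch q q (n - j) * qpoch c q j))
         = qpoch b q n / (qpoch q q n * qpoch c q n)"
  using c
proof (induction n arbitrary: c)
  case (Suc n)
  define T where "T = (\<lambda>c n j. q ^ (j choose 2) * (\<Prod>i<j. c * q ^ i - b)
            / (qpoch q q j * qpoch q q (n - j) * qpoch c q j))"
  have qnz: "qpoch q q j \<noteq> 0" for j
    using q by (intro qpoch_nonzero) simp
  have cnz: "qpoch c q j \<noteq> 0" for j
    by (intro qpoch_nonzero Suc.prems)
  have c1: "c * q * q ^ i \<noteq> 1" for i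
    using Suc.prems[of "Suc i"] by (simp add: mult_ac)
  have cnz1: "qpoch (c * q) q j \<noteq> 0" for j
    by (intro qpoch_nonzero c1)
  have c0: "1 - c \<noteq> 0" and q0: "1 - q ^ Suc n \<noteq> 0" for n
    using Suc.prems[of 0] q[of n] by auto
  have split0: "T c (Suc n) 0 * (1 - q ^ Suc n) = T c n 0"
    using qnz[of "Suc n"] qnz[of n] q0[of n] by (simp add: T_def qpoch_Suc)
  have shift: "T c (Suc n) (Suc j) * (1 - q ^ Suc j) = 
      q ^ j * ((c - b) / (1 - c)) * T (c * q) n j" if "j \<le> n" for j
  proof -
    have "(\<Prod>i<Suc j. c * q ^ i - b) = (c - b) * (\<Prod>i<j. c * q * q ^ i - b)"
      by (subst prod.lessThan_Suc_shift) (simp add: mult_ac)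
    then show ?thesis
      using qnz[of "Suc j"] qnz[of j] q0[of j] c0
      by (simp add: T_def qpoch_Suc[of q] qpoch_Suc_left[of c] Suc_choose_2 power_add mult_ac)
  qed
  have split1: "T c (Suc n) (Suc j) * (1 - q ^ Suc n) = 
      (if j < n then T c n (Suc j) else 0) + q ^ n * ((c - b) / (1 - c)) * T (c * q) n j"
    if "j \<le> n" for j
  proof -
    have "1 - q ^ Suc n = (1 - q ^ (n - j)) + q ^ (n - j) * (1 - q ^ Suc j)"
      using that by (simp add: algebra_simps flip: power_add)
    then have "T c (Suc n) (Suc j) * (1 - q ^ Suc n)
      = T c (Suc n) (Suc j) * (1 - q ^ (n - j)) + q ^ (n - j) * (T c (Suc n) (Suc j) * (1 - q ^ Suc j))"
      by (simp only: ring_distribs mult_ac)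
    also have "q ^ (n - j) * (T c (Suc n) (Suc j) * (1 - q ^ Suc j)) 
        = q ^ n * ((c - b) / (1 - c)) * T (c * q) n j"
    proof -
      have "q ^ (n - j) * q ^ j = q ^ n"
        using that by (simp flip: power_add)
      then show ?thesis
        by (simp only: shift[OF that] mult.assoc[symmetric])
    qed
    also have "T c (Suc n) (Suc j) * (1 - q ^ (n - j)) = (if j < n then T c n (Suc j) else 0)"
    proof (cases "j < n")
      case True
      then obtain d where d: "n = Suc (j + d)"
        using less_imp_Suc_add by blast
      show ?thesis
        using qnz[of "Suc d"] qnz[of d] q0[of d] by (simp add: d T_def qpoch_Suc)
    qed (use that in auto)
    finally show ?thesis .
  qed
  have "(\<Sum>j\<le>Suc n. T c (Suc n) j) * (1 - q ^ Suc n)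
    = T c n 0 + (\<Sum>j\<le>n. T c (Suc n) (Suc j) * (1 - q ^ Suc n))"
    by (subst sum.atMost_Suc_shift) (simp only: split0 distrib_right sum_distrib_right)
  also have "\<dots> = T c n 0 + (\<Sum>j\<le>n. (if j < n then T c n (Suc j) else 0)) 
     + q ^ n * ((c - b) / (1 - c)) * (\<Sum>j\<le>n. T (c * q) n j)"
  proof -
    have "(\<Sum>j\<le>n. T c (Suc n) (Suc j) * (1 - q ^ Suc n)) = (\<Sum>j\<le>n. (if j < n then T c n (Suc j) else 0)
       + q ^ n * ((c - b) / (1 - c)) * T (c * q) n j)"
      by (intro sum.cong refl split1) simp
    then show ?thesis
      by (simp only: sum.distrib sum_distrib_left add.assoc)
  qed
  also have "T c n 0 + (\<Sum>j\<le>n. (if j < n then T c n (Suc j) else 0)) = (\<Sum>j\<le>n. T c n j)"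
  proof (cases n)
    case (Suc n')
    have "(\<Sum>j\<le>n. (if j < n then T c n (Suc j) else 0)) = (\<Sum>j\<le>n'. T c n (Suc j))"
      unfolding Suc by simp
    then show ?thesis
      using sum.atMost_Suc_shift[of "T c n" n'] by (simp add: Suc)
  qed simp
  also have "(\<Sum>j\<le>n. T c n j) = qpoch b q n / (qpoch q q n * qpoch c q n)"
    unfolding T_def by (rule Suc.IH[OF Suc.prems])
  also have "(\<Sum>j\<le>n. T (c * q) n j) = qpoch b q n / (qpoch q q n * qpoch (c * q) q n)"
    unfolding T_def by (rule Suc.IH[OF c1])
  also have "qpoch (c * q) q n = qpoch c q n * (1 - c * q ^ n) / (1 - c)"
    using c0 qpoch_Suc[of c q n] qpoch_Suc_left[of c q n] by (simp add: field_simps)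
  also have "qpoch b q n / (qpoch q q n * qpoch c q n) + q ^ n * ((c - b) / (1 - c)) *
      (qpoch b q n / (qpoch q q n * (qpoch c q n * (1 - c * q ^ n) / (1 - c))))
    = qpoch b q (Suc n) / (qpoch q q n * qpoch c q (Suc n))"
  proof -
    have "1 - c * q ^ n \<noteq> 0" using Suc.prems[of n] by simp
    then show ?thesis
      using c0 qnz[of n] cnz[of n] by (simp add: qpoch_Suc divide_simps) (simp add: algebra_simps)
  qed
  finally have "(\<Sum>j\<le>Suc n. T c (Suc n) j)
      = qpoch b q (Suc n) / (qpoch q q n * qpoch c q (Suc n)) / (1 - q ^ Suc n)"
    using q0[of n] by (simp only: eq_divide_eq) simp
  then show ?case
    unfolding T_def by (simp add: qpoch_Suc[of q q] mult_ac del: sum.atMost_Suc)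
qed simp

text \<open>
  The case \<open>b = 0\<close>, \<open>c = q\<^bsup>d+1\<^esup>\<close> of the q-Vandermonde sum. It is the single step of the Bailey
  chain: it sums out one of the variables \<open>n\<^sub>i\<close> and leaves a summand of the same shape.
\<close>
lemma q_Vandermonde_Durfee:
  fixes q :: "'a::field"
  assumes q: "\<And>i. q ^ Suc i \<noteq> 1"
  shows "(\<Sum>l\<le>p. q ^ (l * (l + d)) / (qpoch q q (p - l) * qpoch q q l * qpoch q q (l + d)))
         = 1 / (qpoch q q p * qpoch q q (p + d))"
proof -
  have qnz: "qpoch q q j \<noteq> 0" for j
    using q by (intro qpoch_nonzero) simp
  have cq: "q * q ^ d * q ^ i \<noteq> 1" for i
    using q[of "d + i"] by (simp add: power_add mult_ac)
  have shift: "qpoch q q (j + d) = qpoch q q d * qpoch (q * q ^ d) q j" for j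
    by (simp add: add.commute qpoch_add)
  have exponent: "l * (l + d) = (l choose 2) + (l choose 2) + l * Suc d" for l
    by (induction l) (simp_all add: Suc_choose_2 algebra_simps)
  have pow: "q ^ (l * (l + d)) = q ^ (l choose 2) * (\<Prod>i<l. q * q ^ d * q ^ i - 0)" for l
  proof -
    have "(\<Prod>i<l. q * q ^ d * q ^ i) = q ^ (l * Suc d) * q ^ (l choose 2)"
      by (subst prod_mult_power) (simp only: mult.commute[of l] power_mult power_Suc)
    then show ?thesis
      by (simp add: exponent power_add mult_ac)
  qed
  have "(\<Sum>l\<le>p. q ^ (l * (l + d)) / (qpoch q q (p - l) * qpoch q q l * qpoch q q (l + d)))
     = (\<Sum>l\<le>p. q ^ (l choose 2) * (\<Prod>i<l. q * q ^ d * q ^ i - 0)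
            / (qpoch q q l * qpoch q q (p - l) * qpoch (q * q ^ d) q l)) / qpoch q q d"
    unfolding sum_divide_distrib pow shift by (intro sum.cong refl) (simp add: mult_ac)
  also have "\<dots> = 1 / (qpoch q q p * qpoch q q (p + d))"
    by (subst q_Vandermonde[OF q cq]) (simp add: shift qpoch_def[of 0])
  finally show ?thesis .
qed

text \<open>
  The case \<open>c = 0\<close> of the q-Vandermonde sum.
\<close>
lemma q_binomial_theorem:
  fixes q x :: "'a::field"
  assumes q: "\<And>i. q ^ Suc i \<noteq> 1"
  shows "(\<Sum>j\<le>n. q ^ (j choose 2) * x ^ j / (qpoch q q j * qpoch q q (n - j)))
         = qpoch (- x) q n / qpoch q q n"
  using q_Vandermonde[where q = q and c = 0 and b = "- x" and n = n, OF q] by (simp add: qpoch_def[of 0])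

lemma qpoch_minus_1: "qpoch (- 1) q (Suc n) = 2 * qpoch (- q) q n"
  by (simp add: qpoch_Suc_left)

text \<open>
  The case \<open>c = - q\<close>, \<open>b = - q\<^bsup>1-m\<^esup>\<close> with \<open>m = p + 1\<close>, multiplied by \<open>q\<close> to the power \<open>m choose 2\<close> in order
  to clear the negative exponents. Here \<open>a = c / b = q\<^sup>m\<close>, which is why \<open>qpoch q q (p + j)\<close> appears. This
  sum performs the summation over all \<open>r\<close> and \<open>j\<close> with \<open>r + j = m\<close>.
\<close>
lemma q_Vandermonde_half:
  fixes q :: "'a::field_char_0"
  assumes q: "\<And>i. q ^ Suc i \<noteq> 1" and q0: "q \<noteq> 0"
  shows "(\<Sum>j\<le>Suc p. q ^ (Suc p - j choose 2) * qpoch q q (p + j)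
            / (qpoch q q (Suc p - j) * qpoch q q j * qpoch (- 1) q (j + 1)))
         = 1 / (1 - q ^ (2 * Suc p))"
proof -
  define m where "m = Suc p"
  have qnz: "qpoch q q j \<noteq> 0" for j
    using q by (intro qpoch_nonzero) simp
  have neg: "- q * q ^ i \<noteq> 1" for i
  proof
    assume "- q * q ^ i = 1"
    then have "q ^ Suc i = - 1" by (metis minus_minus mult_minus_left power_Suc)
    then have "(q ^ Suc i) ^ 2 = 1" by simp
    then have "q ^ (Suc i * 2) = 1" by (simp only: power_mult)
    then have "q ^ Suc (2 * i + 1) = 1" by (simp add: mult_2_right mult_2)
    with q show False by blast
  qed
  define b where "b = - (q / q ^ m)"
  have negnz: "qpoch (- q) q j \<noteq> 0" for j
    by (intro qpoch_nonzero neg)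
  have fac: "(\<Prod>i<j. - q * q ^ i - b) = (q / q ^ m) ^ j * (qpoch q q (p + j) / qpoch q q p)" for j
  proof -
    have "(\<Prod>i<j. - q * q ^ i - b) = (\<Prod>i<j. (q / q ^ m) * (1 - q * q ^ p * q ^ i))"
      using q0 by (intro prod.cong refl) (simp add: b_def m_def field_simps)
    also have "\<dots> = (q / q ^ m) ^ j * qpoch (q * q ^ p) q j"
      by (subst prod.distrib) (simp add: qpoch_def)
    also have "qpoch (q * q ^ p) q j = qpoch q q (p + j) / qpoch q q p"
      using qnz by (simp add: qpoch_add)
    finally show ?thesis .
  qed
  have ex: "(m choose 2) + (j choose 2) + j = (m - j choose 2) + m * j" if "j \<le> m" for j
  proof -
    have "((j + d) choose 2) + (j choose 2) + j = (d choose 2) + (j + d) * j" for d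
      by (induction j) (simp_all add: Suc_choose_2 algebra_simps)
    from this[of "m - j"] show ?thesis using that by simp
  qed
  have pow: "q ^ (m choose 2) * (q ^ (j choose 2) * (q / q ^ m) ^ j) = q ^ (m - j choose 2)" 
    if "j \<le> m" for j
    using q0 arg_cong[OF ex[OF that], of "\<lambda>i. q ^ i"] 
    by (simp add: power_add power_divide field_simps flip: power_mult)
  have b: "q ^ (m choose 2) * qpoch b q m = 2 * qpoch (- q) q p"
  proof -
    have "q ^ (m choose 2) = (\<Prod>i<m. q ^ i)"
      using prod_mult_power[of 1 q m] by simp
    also have "\<dots> = (\<Prod>i<m. q ^ (m - Suc i))"
      by (rule prod.nat_diff_reindex[symmetric])
    finally have "q ^ (m choose 2) * qpoch b q m = (\<Prod>i<m. q ^ (m - Suc i) * (1 - b * q ^ i))"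
      by (simp add: qpoch_def prod.distrib)
    also have "\<dots> = (\<Prod>i<m. 1 - (-1) * q ^ (m - Suc i))"
    proof (intro prod.cong refl)
      fix i assume "i \<in> {..<m}"
      then have "q ^ m = q * q ^ (m - Suc i) * q ^ i"
        by (simp flip: power_add power_Suc)
      then show "q ^ (m - Suc i) * (1 - b * q ^ i) = 1 - (-1) * q ^ (m - Suc i)"
        using q0 by (simp add: b_def field_simps)
    qed
    also have "\<dots> = qpoch (- 1) q m"
      unfolding qpoch_def by (rule prod.nat_diff_reindex)
    finally show ?thesis by (simp add: m_def qpoch_minus_1)
  qed
  have "(\<Sum>j\<le>m. q ^ (m - j choose 2) * qpoch q q (p + j)
            / (qpoch q q (m - j) * qpoch q q j * qpoch (- 1) q (j + 1)))
    = (\<Sum>j\<le>m. q ^ (j choose 2) * (\<Prod>i<j. - q * q ^ i - b)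
            / (qpoch q q j * qpoch q q (m - j) * qpoch (- q) q j))
       * (q ^ (m choose 2) * qpoch q q p / 2)"
    unfolding sum_distrib_right
  proof (intro sum.cong refl)
    fix j assume "j \<in> {..m}"
    then have "q ^ (m - j choose 2) = q ^ (m choose 2) * (q ^ (j choose 2) * (q / q ^ m) ^ j)"
      by (simp add: pow)
    then show "q ^ (m - j choose 2) * qpoch q q (p + j)
            / (qpoch q q (m - j) * qpoch q q j * qpoch (- 1) q (j + 1))
      = q ^ (j choose 2) * (\<Prod>i<j. - q * q ^ i - b)
            / (qpoch q q j * qpoch q q (m - j) * qpoch (- q) q j)
            * (q ^ (m choose 2) * qpoch q q p / 2)"
      unfolding fac using qnz[of p] by (simp add: qpoch_minus_1 mult_ac)
  qed
  also have "\<dots> = (q ^ (m choose 2) * qpoch b q m) * qpoch q q p / (2 * qpoch q q m * qpoch (- q) q m)"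
    by (subst q_Vandermonde[OF q neg]) (simp add: mult_ac)
  also have "\<dots> = 1 / ((1 - q ^ m) * (1 + q ^ m))"
    unfolding b using qnz[of p] negnz[of p] by (simp add: m_def qpoch_Suc)
  also have "(1 - q ^ m) * (1 + q ^ m) = 1 - q ^ (2 * m)"
    by (simp add: algebra_simps power_mult power2_eq_square mult_2_right power_mult_distrib mult_2 power_add)
  finally show ?thesis unfolding m_def .
qed

section \<open>Infinite q-products, analytically and formally\<close>

text \<open>
  Bounds that are uniform in \<open>q\<close> on a disc and in the length of the product; they dominate every
  series below. Both come from \<open>1 + x \<le> exp x\<close>, the second one applied to
  \<open>1 / (1 - x) = 1 + x / (1 - x)\<close>. The exponent \<open>S * S\<close> serves both: it bounds the sum of
  \<open>S * \<rho>\<^sup>i\<close>, and it bounds the sum of \<open>\<rho>\<^sup>i\<close> because \<open>S \<ge> 1\<close>.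
\<close>
lemma qpoch_bounds:
  fixes \<rho> :: real
  assumes "0 \<le> \<rho>" "\<rho> < 1"
  obtains K where "K \<ge> 1"
    "\<And>(a::complex) q n. norm q \<le> \<rho> \<Longrightarrow> norm a \<le> 1 \<Longrightarrow> norm (qpoch a q n) \<le> K"
    "\<And>(a::complex) q n. norm q \<le> \<rho> \<Longrightarrow> norm a \<le> \<rho> \<Longrightarrow> norm (inverse (qpoch a q n)) \<le> K"
proof
  define S where "S = 1 / (1 - \<rho>)"
  have S1: "S \<ge> 1" using assms by (simp add: S_def)
  have geo: "(\<Sum>i<n. \<rho> ^ i) \<le> S" for n
    using assms sum_le_suminf[of "\<lambda>i. \<rho> ^ i" "{..<n}"] by (simp add: S_def suminf_geometric summable_geometric)
  show "exp (S * S) \<ge> 1" using S1 by simp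
  fix a q :: complex and n :: nat
  assume q: "norm q \<le> \<rho>"
  have aq: "norm (a * q ^ i) \<le> norm a * \<rho> ^ i" for i
    using q by (simp add: norm_mult norm_power mult_left_mono power_mono)
  show "norm (qpoch a q n) \<le> exp (S * S)" if a: "norm a \<le> 1"
  proof -
    have "norm (qpoch a q n) \<le> (\<Prod>i<n. 1 + \<rho> ^ i)"
      unfolding qpoch_def prod_norm [symmetric]
    proof (intro prod_mono conjI norm_ge_zero)
      fix i
      have "norm (1 - a * q ^ i) \<le> 1 + norm (a * q ^ i)"
        by (metis norm_one norm_triangle_ineq4)
      also have "norm (a * q ^ i) \<le> 1 * \<rho> ^ i"
        using a assms by (intro order.trans[OF aq] mult_right_mono) auto
      finally show "norm (1 - a * q ^ i) \<le> 1 + \<rho> ^ i" by simp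
    qed
    also have "\<dots> \<le> exp (\<Sum>i<n. \<rho> ^ i)"
      using assms by (intro prod_le_exp_sum) auto
    also have "\<dots> \<le> exp (S * S)"
    proof -
      have "S \<le> S * S" using S1 by (simp add: mult_le_cancel_left1)
      then show ?thesis using geo[of n] by simp
    qed
    finally show ?thesis .
  qed
  show "norm (inverse (qpoch a q n)) \<le> exp (S * S)" if a: "norm a \<le> \<rho>"
  proof -
    have "norm (inverse (qpoch a q n)) = (\<Prod>i<n. inverse (norm (1 - a * q ^ i)))"
      by (simp only: qpoch_def norm_inverse prod_norm[symmetric] prod_inversef[symmetric] o_def)
    also have "\<dots> \<le> (\<Prod>i<n. 1 + S * \<rho> ^ i)"
    proof (intro prod_mono conjI)
      fix i
      have 1: "norm (a * q ^ i) \<le> \<rho> * \<rho> ^ i"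
        using a assms by (intro order.trans[OF aq] mult_right_mono) auto
      have 2: "\<rho> * \<rho> ^ i \<le> \<rho>"
        using assms by (simp add: mult_le_cancel_left1 power_le_one mult_left_le)
      have 3: "1 - \<rho> * \<rho> ^ i \<le> norm (1 - a * q ^ i)"
        using 1 norm_triangle_ineq2[of 1 "a * q ^ i"] by simp
      have "inverse (norm (1 - a * q ^ i)) \<le> inverse (1 - \<rho> * \<rho> ^ i)"
        using 2 3 assms by (intro le_imp_inverse_le) auto
      also have "\<dots> = 1 + \<rho> * \<rho> ^ i / (1 - \<rho> * \<rho> ^ i)"
        using 2 assms by (simp add: field_simps)
      also have "\<rho> * \<rho> ^ i / (1 - \<rho> * \<rho> ^ i) \<le> \<rho> ^ i / (1 - \<rho>)"
        using 2 assms by (intro frac_le) (auto simp: mult_left_le_one_le)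
      finally show "inverse (norm (1 - a * q ^ i)) \<le> 1 + S * \<rho> ^ i"
        by (simp add: S_def)
    qed auto
    also have "\<dots> \<le> exp (\<Sum>i<n. S * \<rho> ^ i)"
      using assms S1 by (intro prod_le_exp_sum) auto
    also have "\<dots> \<le> exp (S * S)"
      using geo[of n] S1 by (simp flip: sum_distrib_left)
    finally show ?thesis .
  qed
qed

lemma qpoch_inverse_bounded:
  fixes q :: complex
  assumes q: "norm q < 1"
  obtains K where "K \<ge> 1" "\<And>n. norm (inverse (qpoch q q n)) \<le> K"
proof (rule qpoch_bounds[of "norm q"])
  fix K :: real
  assume "K \<ge> 1" "\<And>(a::complex) p n. norm p \<le> norm q \<Longrightarrow> norm a \<le> norm q \<Longrightarrow> norm (inverse (qpoch a p n)) \<le> K"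
  then show ?thesis using that by blast
qed (use q in auto)

lemma convergent_prod_qpoch:
  fixes a q :: complex
  assumes "norm q < 1"
  shows "convergent_prod (\<lambda>i. 1 - a * q ^ i)"
proof (intro abs_convergent_prod_imp_convergent_prod summable_imp_abs_convergent_prod)
  have "summable (\<lambda>i. norm a * norm q ^ i)"
    using assms by (intro summable_mult summable_geometric) auto
  then show "summable (\<lambda>i. norm (1 - a * q ^ i - 1))"
    by (simp add: norm_mult norm_power)
qed

lemma qpoch_tendsto_qpoch_inf:
  fixes a q :: complex
  assumes "norm q < 1"
  shows "qpoch a q \<longlonglongrightarrow> qpoch_inf a q"
  using convergent_prod_LIMSEQ[OF convergent_prod_qpoch[OF assms, of a]]
  unfolding LIMSEQ_lessThan_iff_atMost[symmetric]
  by (simp add: qpoch_inf_def qpoch_def[abs_def])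

lemma power_neq_1:
  fixes q :: complex
  assumes "norm q < 1"
  shows "q ^ Suc i \<noteq> 1"
proof
  assume "q ^ Suc i = 1"
  then have "norm q ^ Suc i = 1" by (metis norm_one norm_power)
  moreover have "norm q ^ Suc i \<le> norm q ^ 1"
    using assms by (intro power_decreasing) auto
  ultimately show False using assms by simp
qed

lemma qpoch_inf_nonzero:
  fixes a q :: complex
  assumes "norm q < 1" "norm a < 1"
  shows "qpoch_inf a q \<noteq> 0"
  unfolding qpoch_inf_def
proof (intro prodinf_nonzero convergent_prod_qpoch assms)
  fix i
  have "norm (a * q ^ i) < 1"
  proof -
    have "norm a * norm q ^ i \<le> norm a * 1"
      using assms by (intro mult_left_mono power_le_one) auto
    then show ?thesis
      using assms by (simp add: norm_mult norm_power)
  qed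
  then show "1 - a * q ^ i \<noteq> 0" by auto
qed

lemma holomorphic_on_unit_ballI:
  assumes "\<And>\<rho>. 0 < \<rho> \<Longrightarrow> \<rho> < 1 \<Longrightarrow> f holomorphic_on ball 0 \<rho>"
  shows "f holomorphic_on ball 0 1"
proof -
  have "(ball 0 1 :: complex set) = (\<Union>\<rho>\<in>{0<..<1}. ball 0 \<rho>)"
  proof (intro equalityI subsetI)
    fix z :: complex assume "z \<in> ball 0 1"
    then have "0 < (1 + norm z) / 2" "(1 + norm z) / 2 < 1" "norm z < (1 + norm z) / 2"
      by (auto simp: add_pos_nonneg)
    then show "z \<in> (\<Union>\<rho>\<in>{0<..<1}. ball 0 \<rho>)"
      by (intro UN_I[of "(1 + norm z) / 2"]) auto
  qed auto
  then show ?thesis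
    using assms by (auto intro!: holomorphic_on_UN_open)
qed

text \<open>
  Uniformity in \<open>q\<close> makes the infinite product holomorphic and, below, links its Taylor
  coefficients to those of the formal product.
\<close>
lemma uniform_limit_qpoch_inf:
  fixes c :: complex and d e :: nat
  assumes d: "d \<ge> 1" and \<rho>: "0 \<le> \<rho>" "\<rho> < 1"
  shows "uniform_limit (cball 0 \<rho>) (\<lambda>n q. qpoch (c * q ^ e) (q ^ d) n)
           (\<lambda>q. qpoch_inf (c * q ^ e) (q ^ d)) sequentially"
proof -
  have bound: "norm (1 - c * q ^ e * (q ^ d) ^ n - 1) \<le> norm c * \<rho> ^ n" if "q \<in> cball 0 \<rho>" for q n
  proof -
    have "norm q ^ e * (norm q ^ d) ^ n \<le> 1 * \<rho> ^ n"
    proof (intro mult_mono power_mono)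
      show "norm q ^ e \<le> 1" using that \<rho> by (intro power_le_one) auto
      have "norm q ^ d \<le> norm q ^ 1" using that \<rho> d by (intro power_decreasing) auto
      then show "norm q ^ d \<le> \<rho>" using that by simp
    qed auto
    then have "norm c * (norm q ^ e * (norm q ^ d) ^ n) \<le> norm c * \<rho> ^ n"
      by (intro mult_left_mono) auto
    then show ?thesis by (simp add: norm_mult norm_power mult.assoc)
  qed
  have "uniformly_convergent_on (cball 0 \<rho>) (\<lambda>N q. \<Prod>n<N. 1 - c * q ^ e * (q ^ d) ^ n)"
  proof (rule uniformly_convergent_on_prod')
    show "uniformly_convergent_on (cball 0 \<rho>) (\<lambda>N q. \<Sum>n<N. norm (1 - c * q ^ e * (q ^ d) ^ n - 1))"
    proof (rule Weierstrass_m_test')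
      show "summable (\<lambda>n. norm c * \<rho> ^ n)"
        using \<rho> by (intro summable_mult summable_geometric) auto
    qed (use bound in auto)
  qed (auto intro!: continuous_intros)
  then have "uniformly_convergent_on (cball 0 \<rho>) (\<lambda>n q. qpoch (c * q ^ e) (q ^ d) n)"
    by (simp add: qpoch_def)
  then obtain l where l: "uniform_limit (cball 0 \<rho>) (\<lambda>n q. qpoch (c * q ^ e) (q ^ d) n) l sequentially"
    by (auto simp: uniformly_convergent_on_def)
  have "l q = qpoch_inf (c * q ^ e) (q ^ d)" if "q \<in> cball 0 \<rho>" for q
  proof (rule LIMSEQ_unique)
    show "(\<lambda>n. qpoch (c * q ^ e) (q ^ d) n) \<longlonglongrightarrow> l q"
      using l that by (rule tendsto_uniform_limitI)
    have "norm q ^ d \<le> norm q ^ 1" using that \<rho> d by (intro power_decreasing) auto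
    then show "(\<lambda>n. qpoch (c * q ^ e) (q ^ d) n) \<longlonglongrightarrow> qpoch_inf (c * q ^ e) (q ^ d)"
      using that \<rho> by (intro qpoch_tendsto_qpoch_inf) (simp add: norm_power)
  qed
  then show ?thesis
    using l by (subst uniform_limit_cong'[of _ _ _ _ l]) auto
qed

lemma qpoch_holomorphic: "(\<lambda>q::complex. qpoch (c * q ^ e) (q ^ d) n) holomorphic_on A"
  unfolding qpoch_def by (intro holomorphic_intros)

lemma qpoch_has_fps_expansion:
  "(\<lambda>q::complex. qpoch (c * q ^ e) (q ^ d) n) has_fps_expansion
     qpoch (fps_const c * fps_X ^ e) (fps_X ^ d) n"
  unfolding qpoch_def by (intro fps_expansion_intros)

lemma qpoch_inf_holomorphic:
  assumes d: "d \<ge> 1"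
  shows "(\<lambda>q::complex. qpoch_inf (c * q ^ e) (q ^ d)) holomorphic_on ball 0 1"
proof -
  have "(\<lambda>q. qpoch_inf (c * q ^ e) (q ^ d)) holomorphic_on ball 0 \<rho>" if "\<rho> < 1" "\<rho> > 0" for \<rho>
    using holomorphic_uniform_limit[of 0 \<rho>, OF _ uniform_limit_qpoch_inf[OF d, of \<rho> c e]] that
    by (auto intro!: always_eventually holomorphic_on_imp_continuous_on qpoch_holomorphic)
  then show ?thesis by (intro holomorphic_on_unit_ballI)
qed

text \<open>
  In the topology of formal power series the partial products become stationary in each degree:
  the factor of index \<open>n\<close> differs from 1 only in degrees above \<open>n\<close>. The limit has constant
  coefficient 1 and so is nonzero, as the definition of an infinite product requires.
\<close>
lemma qpoch_fps_tendsto_qpoch_inf: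
  fixes c :: complex
  assumes d: "d \<ge> 1" and e: "e \<ge> 1"
  defines "a \<equiv> fps_const c * fps_X ^ e"
  shows "qpoch a (fps_X ^ d) \<longlonglongrightarrow> qpoch_inf a (fps_X ^ d)" "fps_nth (qpoch_inf a (fps_X ^ d)) 0 = 1"
proof -
  define f where "f = (\<lambda>i. 1 - a * (fps_X ^ d) ^ i)"
  define P where "P = (\<lambda>n. qpoch a (fps_X ^ d) n)"
  have P_Suc: "P (Suc n) = P n - fps_const c * (fps_X ^ (e + d * n) * P n)" for n
    by (simp add: P_def qpoch_Suc a_def algebra_simps power_add power_mult)
  have step: "fps_nth (P (Suc n)) i = fps_nth (P n) i" if "i \<le> n" for i n
  proof -
    have "n \<le> d * n" using d by (cases d) auto
    then have "i < e + d * n" using that e by linarith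
    then show ?thesis by (simp add: P_Suc fps_X_power_mult_nth)
  qed
  have stable: "fps_nth (P n) i = fps_nth (P i) i" if "n \<ge> i" for n i
    using that by (induction n rule: dec_induct) (simp_all add: step)
  define G where "G = Abs_fps (\<lambda>i. fps_nth (P i) i)"
  have lim: "P \<longlonglongrightarrow> G"
    by (rule tendsto_fpsI) (auto simp: G_def eventually_sequentially intro: stable)
  have G0: "fps_nth G 0 = 1" by (simp add: G_def P_def)
  have f0: "fps_nth (f i) 0 = 1" for i
    using e by (auto simp: f_def a_def)
  have raw: "raw_has_prod f 0 p \<longleftrightarrow> P \<longlonglongrightarrow> p \<and> p \<noteq> 0" for p
    unfolding raw_has_prod_def P_def qpoch_def f_def 
    by (simp add: LIMSEQ_lessThan_iff_atMost)
  have "f has_prod p \<longleftrightarrow> p = G" for p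
  proof -
    have "f i \<noteq> 0" for i using f0[of i] by auto
    moreover have "G \<noteq> 0" using G0 by auto
    ultimately show ?thesis
      unfolding has_prod_def raw using lim LIMSEQ_unique by auto
  qed
  then have "qpoch_inf a (fps_X ^ d) = G"
    by (simp add: qpoch_inf_def prodinf_def flip: f_def)
  with lim G0 show "qpoch a (fps_X ^ d) \<longlonglongrightarrow> qpoch_inf a (fps_X ^ d)" 
    "fps_nth (qpoch_inf a (fps_X ^ d)) 0 = 1"
    by (simp_all add: P_def)
qed

text \<open>
  Formal and uniform convergence of the same partial products force the two limits to correspond.
\<close>
lemma qpoch_inf_has_fps_expansion:
  fixes c :: complex
  assumes d: "d \<ge> 1" and e: "e \<ge> 1"
  shows "(\<lambda>q. qpoch_inf (c * q ^ e) (q ^ d)) has_fps_expansion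
           qpoch_inf (fps_const c * fps_X ^ e) (fps_X ^ d)"
proof -
  define g where "g = (\<lambda>q. qpoch_inf (c * q ^ e) (q ^ d))"
  have exp: "g has_fps_expansion fps_expansion g 0"
    unfolding g_def
    by (rule has_fps_expansion_fps_expansion[OF _ _ qpoch_inf_holomorphic[OF d]]) auto
  have "fps_expansion g 0 = qpoch_inf (fps_const c * fps_X ^ e) (fps_X ^ d)"
  proof (rule uniform_limit_imp_fps_expansion_eq)
    show "uniform_limit (ball 0 (1/2)) (\<lambda>n q. qpoch (c * q ^ e) (q ^ d) n) g sequentially"
      unfolding g_def
      by (rule uniform_limit_on_subset[OF uniform_limit_qpoch_inf[OF d, of "1/2"]]) auto
    show "\<forall>\<^sub>F n in sequentially. (\<lambda>q. qpoch (c * q ^ e) (q ^ d) n) has_fps_expansion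
             qpoch (fps_const c * fps_X ^ e) (fps_X ^ d) n"
      by (intro always_eventually allI qpoch_has_fps_expansion)
    show "\<forall>\<^sub>F n in sequentially. (\<lambda>q. qpoch (c * q ^ e) (q ^ d) n) holomorphic_on ball 0 (1/2)"
      by (intro always_eventually allI qpoch_holomorphic)
  qed (use exp qpoch_fps_tendsto_qpoch_inf[OF d e] in auto)
  with exp show ?thesis by (simp add: g_def)
qed

section \<open>The Durfee series and the Jacobi triple product\<close>

text \<open>
  Tannery's theorem for sums whose number of terms grows with the parameter.
\<close>
lemma limit_of_sums_has_sum:
  fixes a :: "nat \<Rightarrow> nat \<Rightarrow> complex"
  assumes lim: "\<And>k. (\<lambda>n. a k n) \<longlonglongrightarrow> b k"
    and bound: "\<And>k n. k \<le> n \<Longrightarrow> norm (a k n) \<le> M k" and M: "summable M"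
    and S: "(\<lambda>n. \<Sum>k\<le>n. a k n) \<longlonglongrightarrow> S"
  shows "(b has_sum S) UNIV"
proof -
  define a' where "a' = (\<lambda>k n. if k \<le> n then a k n else 0)"
  have M0: "0 \<le> M k" for k
    using bound[of k k] norm_ge_zero order.trans by blast
  have lim': "(\<lambda>n. a' k n) \<longlonglongrightarrow> b k" for k
    by (rule Lim_transform_eventually[OF lim]) (auto simp: a'_def eventually_sequentially)
  have "eventually (\<lambda>(k, n). norm (a' k n) \<le> M k) (at_top \<times>\<^sub>F sequentially)"
    by (intro always_eventually) (auto simp: a'_def bound M0)
  note * = tannerys_theorem[of a' b sequentially M, OF lim' this M]
  have "(\<Sum>k. a' k n) = (\<Sum>k\<le>n. a k n)" for n
    by (subst suminf_finite[of "{..n}"]) (auto simp: a'_def)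
  then have "suminf b = S"
    using * S LIMSEQ_unique by auto
  have b: "summable (\<lambda>k. norm (b k))" using * by auto
  then have "b sums S"
    using summable_sums[OF summable_norm_cancel[OF b]] \<open>suminf b = S\<close> by simp
  then show ?thesis
    by (intro norm_summable_imp_has_sum b)
qed

text \<open>
  The limit \<open>p \<rightarrow> \<infinity>\<close> of \<open>q_Vandermonde_Durfee\<close>; combinatorially, the Durfee rectangle dissection of partitions.
\<close>
lemma qpoch_inf_Durfee:
  fixes q :: complex
  assumes q: "norm q < 1"
  shows "((\<lambda>l. q ^ (l * (l + d)) / (qpoch q q l * qpoch q q (l + d))) has_sum 1 / qpoch_inf q q) UNIV"
proof -
  note q1 = power_neq_1[OF q]
  have qnz: "qpoch q q j \<noteq> 0" for j
    using q1 by (intro qpoch_nonzero) simp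
  have nz: "qpoch_inf q q \<noteq> 0" by (intro qpoch_inf_nonzero q)
  note lim = qpoch_tendsto_qpoch_inf[OF q, of q]
  obtain K where K: "K \<ge> 1" "\<And>n. norm (inverse (qpoch q q n)) \<le> K"
    using qpoch_inverse_bounded[OF q] by blast
  define a where "a = (\<lambda>l p. q ^ (l * (l + d)) / (qpoch q q (p - l) * qpoch q q l * qpoch q q (l + d)))"
  have "((\<lambda>l. q ^ (l * (l + d)) / (qpoch_inf q q * qpoch q q l * qpoch q q (l + d))) has_sum
          1 / (qpoch_inf q q * qpoch_inf q q)) UNIV"
  proof (rule limit_of_sums_has_sum)
    show "(\<lambda>p. a l p) \<longlonglongrightarrow> q ^ (l * (l + d)) / (qpoch_inf q q * qpoch q q l * qpoch q q (l + d))" for l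
    proof -
      have "(\<lambda>p. qpoch q q (p - l)) \<longlonglongrightarrow> qpoch_inf q q"
        by (rule LIMSEQ_offset[of _ l]) (use lim in simp)
      then show ?thesis
        unfolding a_def by (intro tendsto_intros) (use nz qnz in auto)
    qed
    show "norm (a l p) \<le> norm q ^ l * (K * K * K)" for l p
    proof -
      have "norm (a l p) = norm q ^ (l * (l + d)) * (norm (inverse (qpoch q q (p - l))) *
         norm (inverse (qpoch q q l)) * norm (inverse (qpoch q q (l + d))))"
        by (simp add: a_def norm_mult norm_divide norm_power norm_inverse divide_inverse)
      also have "\<dots> \<le> norm q ^ l * (K * K * K)"
        using q K by (intro mult_mono power_decreasing mult_nonneg_nonneg) auto
      finally show ?thesis .
    qed
    show "summable (\<lambda>l. norm q ^ l * (K * K * K))"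
      using q by (intro summable_mult2 summable_geometric) auto
    show "(\<lambda>p. \<Sum>l\<le>p. a l p) \<longlonglongrightarrow> 1 / (qpoch_inf q q * qpoch_inf q q)"
      unfolding a_def q_Vandermonde_Durfee[OF q1]
      by (intro tendsto_intros lim LIMSEQ_ignore_initial_segment) (use nz in auto)
  qed
  from has_sum_cmult_right[OF this, of "qpoch_inf q q"] show ?thesis
    using nz by (simp add: mult.assoc)
qed

lemma sum_from_centre:
  fixes f :: "nat \<Rightarrow> 'a::comm_monoid_add"
  shows "(\<Sum>j\<le>2 * n. f j) = (\<Sum>m\<le>n. if m = 0 then f n else f (n + m) + f (n - m))"
proof (induction n arbitrary: f)
  case (Suc n)
  have "(\<Sum>j\<le>2 * Suc n. f j) = (\<Sum>j\<le>2 * n. f (Suc j)) + (f (2 * n + 2) + f 0)"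
  proof -
    have "(\<Sum>j\<le>2 * Suc n. f j) = (\<Sum>j\<le>Suc (2 * n). f j) + f (2 * n + 2)"
      by simp
    also have "(\<Sum>j\<le>Suc (2 * n). f j) = f 0 + (\<Sum>j\<le>2 * n. f (Suc j))"
      by (rule sum.atMost_Suc_shift)
    finally show ?thesis by (simp add: add_ac)
  qed
  also have "(\<Sum>j\<le>2 * n. f (Suc j)) = 
      (\<Sum>m\<le>n. if m = 0 then f (Suc n) else f (Suc n + m) + f (Suc n - m))"
    unfolding Suc.IH by (intro sum.cong refl) (simp add: Suc_diff_le)
  finally show ?case by (simp add: mult_2)
qed simp

text \<open>
  The terms of index \<open>m\<close> and \<open>- m\<close> of the two-sided theta series
  \<open>\<Sum>m. q\<^bsup>m(m-1)/2\<^esup> x\<^sup>m\<close>, combined so that the series runs over the natural numbers.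
\<close>
definition theta_term :: "'a::field \<Rightarrow> 'a \<Rightarrow> nat \<Rightarrow> 'a" where
  "theta_term x q m =
     (if m = 0 then 1 else q ^ (m choose 2) * x ^ m + q ^ (Suc m choose 2) / x ^ m)"

text \<open>
  The q-binomial theorem for a product of length \<open>2 n\<close> with \<open>x / q\<^sup>n\<close> in place of \<open>x\<close>. The upper half
  of the factors is the shifted factorial of \<open>- x\<close>; in the lower half the exponents of \<open>q\<close> are
  negative, and taking out \<open>x / q\<^bsup>i+1\<^esup>\<close> from each factor turns it into that of \<open>- q / x\<close>.
\<close>
lemma finite_Jacobi_triple_product:
  fixes q x :: "'a::field"
  assumes q: "\<And>i. q ^ Suc i \<noteq> 1" and q0: "q \<noteq> 0" and x0: "x \<noteq> 0"
  shows "(\<Sum>m\<le>n. theta_term x q m / (qpoch q q (n + m) * qpoch q q (n - m)))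
         = qpoch (- x) q n * qpoch (- (q / x)) q n / qpoch q q (2 * n)"
proof -
  define y where "y = x / q ^ n"
  \<comment> \<open>the inverse of the monomial taken out of the lower half of the factors\<close>
  define c where "c = q ^ (Suc n choose 2) / x ^ n"
  define f where "f = (\<lambda>j. q ^ (j choose 2) * y ^ j / (qpoch q q j * qpoch q q (2 * n - j)))"
  have up: "c * (q ^ (n + m choose 2) * y ^ (n + m)) = q ^ (m choose 2) * x ^ m" for m
  proof -
    have "(Suc n choose 2) + (n + m choose 2) = (m choose 2) + n * (n + m)"
      by (induction n) (simp_all add: Suc_choose_2 algebra_simps)
    then have pw: "q ^ (Suc n choose 2) * q ^ (n + m choose 2) = q ^ (m choose 2) * (q ^ n) ^ (n + m)"
      by (simp only: power_add[symmetric] power_mult[symmetric])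
    have "c * (q ^ (n + m choose 2) * y ^ (n + m))
        = (q ^ (Suc n choose 2) * q ^ (n + m choose 2)) * x ^ (n + m) / (x ^ n * (q ^ n) ^ (n + m))"
      by (simp add: c_def y_def power_divide)
    also have "\<dots> = q ^ (m choose 2) * x ^ m"
      unfolding pw using q0 x0 by (simp add: power_add[of x])
    finally show ?thesis .
  qed
  have down: "c * (q ^ (n - m choose 2) * y ^ (n - m)) = q ^ (Suc m choose 2) / x ^ m" if "m \<le> n" for m
  proof -
    define d where "d = n - m"
    then have d: "n = m + d" using that by simp
    have "(Suc n choose 2) + (d choose 2) = (Suc m choose 2) + n * d"
      unfolding d by (induction d) (simp_all add: Suc_choose_2 algebra_simps)
    then have pw: "q ^ (Suc n choose 2) * q ^ (d choose 2) = q ^ (Suc m choose 2) * (q ^ n) ^ d"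
      by (simp only: power_add[symmetric] power_mult[symmetric])
    have "c * (q ^ (d choose 2) * y ^ d)
        = (q ^ (Suc n choose 2) * q ^ (d choose 2)) * x ^ d / (x ^ (m + d) * (q ^ n) ^ d)"
      by (simp add: c_def y_def power_divide d)
    also have "\<dots> = q ^ (Suc m choose 2) / x ^ m"
      unfolding pw using q0 x0 by (simp add: power_add[of x])
    finally show ?thesis by (simp add: d)
  qed
  have "c * (\<Sum>j\<le>2 * n. f j) = (\<Sum>m\<le>n. theta_term x q m / (qpoch q q (n + m) * qpoch q q (n - m)))"
    unfolding sum_from_centre sum_distrib_left
  proof (intro sum.cong refl)
    fix m assume m: "m \<in> {..n}"
    have "c * f (n + m) = q ^ (m choose 2) * x ^ m / (qpoch q q (n + m) * qpoch q q (n - m))"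
      by (simp add: f_def flip: up)
    moreover have "c * f (n - m) = q ^ (Suc m choose 2) / x ^ m / (qpoch q q (n + m) * qpoch q q (n - m))"
      using m by (simp add: f_def mult_ac flip: down)
    ultimately show "c * (if m = 0 then f n else f (n + m) + f (n - m))
        = theta_term x q m / (qpoch q q (n + m) * qpoch q q (n - m))"
      by (auto simp: theta_term_def ring_distribs add_divide_distrib)
  qed
  moreover have "(\<Sum>j\<le>2 * n. f j) = qpoch (- y) q (2 * n) / qpoch q q (2 * n)"
    unfolding f_def by (rule q_binomial_theorem[OF q])
  moreover have "c * qpoch (- y) q (2 * n) = qpoch (- x) q n * qpoch (- (q / x)) q n"
  proof -
    have "c * qpoch (- y) q n = qpoch (- (q / x)) q n"
    proof -
      have "qpoch (- y) q n = (\<Prod>i<n. 1 + y * q ^ (n - Suc i))"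
        unfolding qpoch_def by (subst prod.nat_diff_reindex[symmetric]) simp
      also have "\<dots> = (\<Prod>i<n. (x / q) * (1 / q) ^ i * (1 - (- (q / x)) * q ^ i))"
      proof (intro prod.cong refl)
        fix i assume "i \<in> {..<n}"
        then have "q ^ n = q * q ^ (n - Suc i) * q ^ i"
          by (simp flip: power_add power_Suc)
        then show "1 + y * q ^ (n - Suc i) = x / q * (1 / q) ^ i * (1 - (- (q / x)) * q ^ i)"
          using q0 x0 by (simp add: y_def power_divide) (simp add: divide_simps)
      qed
      also have "\<dots> = ((x / q) ^ n * (1 / q) ^ (n choose 2)) * qpoch (- (q / x)) q n"
        unfolding qpoch_def prod.distrib prod_mult_power[symmetric] by simp
      finally show ?thesis
        using q0 x0 by (simp add: c_def Suc_choose_2 power_add power_divide)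
    qed
    moreover have yx: "- y * q ^ n = - x" using q0 by (simp add: y_def)
    have "qpoch (- y) q (2 * n) = qpoch (- y) q n * qpoch (- x) q n"
      using qpoch_add[of "- y" q n n] unfolding yx mult_2 .
    ultimately show ?thesis
      by (metis mult.assoc mult.commute)
  qed
  ultimately show ?thesis by simp
qed

text \<open>
  The ratio of consecutive terms is \<open>q\<^sup>m y\<close>, which tends to 0.
\<close>
lemma summable_theta:
  fixes q y :: real
  assumes "0 \<le> q" "q < 1" "0 \<le> y"
  shows "summable (\<lambda>m. q ^ (m choose 2) * y ^ m)"
proof -
  have "(\<lambda>m. q ^ m * y) \<longlonglongrightarrow> 0 * y"
    using assms by (intro tendsto_intros LIMSEQ_realpow_zero)
  then have "eventually (\<lambda>m. q ^ m * y < 1 / 2) sequentially"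
    by (intro order_tendstoD) auto
  then obtain N where N: "\<And>m. m \<ge> N \<Longrightarrow> q ^ m * y < 1 / 2"
    by (auto simp: eventually_sequentially)
  show ?thesis
  proof (rule summable_ratio_test)
    fix m assume "m \<ge> N"
    have "q ^ (Suc m choose 2) * y ^ Suc m = (q ^ m * y) * (q ^ (m choose 2) * y ^ m)"
      by (simp add: Suc_choose_2 power_add)
    also have "\<dots> \<le> 1 / 2 * (q ^ (m choose 2) * y ^ m)"
      using N[OF \<open>m \<ge> N\<close>] assms by (intro mult_right_mono) auto
    finally show "norm (q ^ (Suc m choose 2) * y ^ Suc m) \<le> 1 / 2 * norm (q ^ (m choose 2) * y ^ m)"
      using assms by simp
  qed simp
qed

text \<open>
  The limit \<open>n \<rightarrow> \<infinity>\<close> of the finite version, in which every factor \<open>qpoch q q l\<close> tends to the same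
  nonzero infinite product.
\<close>
theorem Jacobi_triple_product:
  fixes q x :: complex
  assumes q: "norm q < 1" and q0: "q \<noteq> 0" and x0: "x \<noteq> 0"
  shows "(theta_term x q has_sum 
           qpoch_inf (- x) q * qpoch_inf (- (q / x)) q * qpoch_inf q q) UNIV"
proof -
  have nz: "qpoch_inf q q \<noteq> 0" by (intro qpoch_inf_nonzero q)
  note lim = qpoch_tendsto_qpoch_inf[OF q]
  obtain K where K: "K \<ge> 1" "\<And>n. norm (inverse (qpoch q q n)) \<le> K"
    using qpoch_inverse_bounded[OF q] by blast
  define a where "a = (\<lambda>m n. theta_term x q m / (qpoch q q (n + m) * qpoch q q (n - m)))"
  define M where "M = (\<lambda>m. norm q ^ (m choose 2) * norm x ^ m + norm q ^ (m choose 2) * (norm (q / x)) ^ m)"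
  define P where "P = qpoch_inf (- x) q * qpoch_inf (- (q / x)) q"
  have "((\<lambda>m. theta_term x q m / (qpoch_inf q q * qpoch_inf q q)) has_sum P / qpoch_inf q q) UNIV"
  proof (rule limit_of_sums_has_sum)
    show "(\<lambda>n. a m n) \<longlonglongrightarrow> theta_term x q m / (qpoch_inf q q * qpoch_inf q q)" for m
    proof -
      have "(\<lambda>n. qpoch q q (n - m)) \<longlonglongrightarrow> qpoch_inf q q"
        by (rule LIMSEQ_offset[of _ m]) (use lim in simp)
      then show ?thesis
        unfolding a_def by (intro tendsto_intros LIMSEQ_ignore_initial_segment lim) (use nz in auto)
    qed
    show "norm (a m n) \<le> M m * (K * K)" for m n
    proof -
      have t: "norm (theta_term x q m) \<le> M m"
      proof (cases "m = 0")
        case False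
        have "theta_term x q m = q ^ (m choose 2) * x ^ m + q ^ (m choose 2) * (q / x) ^ m"
          using False by (simp add: theta_term_def Suc_choose_2 power_add power_divide)
        then show ?thesis
          using norm_triangle_ineq[of "q ^ (m choose 2) * x ^ m" "q ^ (m choose 2) * (q / x) ^ m"]
          by (simp add: M_def norm_mult norm_power norm_divide)
      qed (simp add: theta_term_def M_def)
      have "norm (a m n) = norm (theta_term x q m) * (norm (inverse (qpoch q q (n + m))) *
         norm (inverse (qpoch q q (n - m))))"
        by (simp add: a_def norm_mult norm_divide norm_inverse divide_inverse)
      also have "\<dots> \<le> M m * (K * K)"
        using t K order.trans[OF norm_ge_zero t] by (intro mult_mono) auto
      finally show ?thesis .
    qed
    show "summable (\<lambda>m. M m * (K * K))"
      unfolding M_def using q by (intro summable_mult2 summable_add summable_theta) auto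
    have "(\<lambda>n. qpoch q q (2 * n)) \<longlonglongrightarrow> qpoch_inf q q"
      using LIMSEQ_subseq_LIMSEQ[OF lim, of "\<lambda>n. 2 * n"] by (simp add: strict_mono_def o_def)
    then show "(\<lambda>n. \<Sum>m\<le>n. a m n) \<longlonglongrightarrow> P / qpoch_inf q q"
      unfolding a_def finite_Jacobi_triple_product[OF power_neq_1[OF q] q0 x0] P_def
      by (intro tendsto_intros lim) (use nz in auto)
  qed
  from has_sum_cmult_right[OF this, of "qpoch_inf q q * qpoch_inf q q"] show ?thesis
    using nz by (simp add: P_def mult.commute)
qed

section \<open>Summation over the chain variables\<close>

lemma summable_on_geometric_PiE:
  fixes \<rho> :: real
  assumes "finite A" "0 \<le> \<rho>" "\<rho> < 1"
  shows "(\<lambda>n. \<Prod>i\<in>A. \<rho> ^ n i) summable_on (PiE A (\<lambda>_. UNIV :: nat set))"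
proof -
  have "Infinite_Set_Sum.abs_summable_on (\<lambda>n. \<Prod>i\<in>A. \<rho> ^ n i) (PiE A (\<lambda>_. UNIV :: nat set))"
    using assms by (intro abs_summable_on_prod_PiE) (auto simp: abs_summable_on_nat_iff' summable_geometric)
  then show ?thesis
    by (simp add: abs_summable_equivalent[symmetric] abs_summable_summable)
qed

lemma summable_on_times_nonneg:
  fixes f :: "'a \<Rightarrow> real" and g :: "'b \<Rightarrow> real"
  assumes "f summable_on A" "g summable_on B" "\<And>x. x \<in> A \<Longrightarrow> 0 \<le> f x" "\<And>y. y \<in> B \<Longrightarrow> 0 \<le> g y"
  shows "(\<lambda>(x, y). f x * g y) summable_on A \<times> B"
proof (rule summable_on_SigmaI)
  show "((\<lambda>y. case (x, y) of (x, y) \<Rightarrow> f x * g y) has_sum f x * infsum g B) B" for x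
    using has_sum_cmult_right[OF has_sum_infsum[OF assms(2)]] by simp
  show "(\<lambda>x. f x * infsum g B) summable_on A"
    by (intro summable_on_cmult_left assms)
qed (use assms in auto)

text \<open>
  The part of the summand that involves \<open>n\<^sub>1, \<dots>, n\<^sub>k\<close>, with \<open>q\<close> standing for \<open>q\<^sup>3\<close>. It depends on
  \<open>r\<close> and \<open>j\<close> only through \<open>m = r + j\<close>, which is what makes the double sum over them collapse.
\<close>
definition chain_weight :: "nat \<Rightarrow> nat \<Rightarrow> 'a::field \<Rightarrow> (nat \<Rightarrow> nat) \<Rightarrow> 'a" where
  "chain_weight k m q n = q ^ (\<Sum>i=1..k. ((\<Sum>l=i..k. n l) + m)\<^sup>2)
     / ((\<Prod>i=1..k. qpoch q q (n i)) * qpoch q q (n k + 2 * m))"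

lemma chain_weight_summable:
  fixes q :: complex
  assumes q: "norm q < 1" and k: "k \<ge> 1"
  shows "chain_weight k m q summable_on (PiE {1..k} (\<lambda>_. UNIV))"
proof -
  obtain K where K: "K \<ge> 1" "\<And>n. norm (inverse (qpoch q q n)) \<le> K"
    using qpoch_inverse_bounded[OF q] by blast
  have bound: "norm (chain_weight k m q n) \<le> (\<Prod>i\<in>{1..k}. norm q ^ n i) * (K ^ k * K)" for n
  proof -
    have "(\<Sum>i=1..k. n i) \<le> (\<Sum>l=1..k. n l) + m" by simp
    also have "\<dots> \<le> ((\<Sum>l=1..k. n l) + m)\<^sup>2" by (rule power2_nat_le_imp_le) simp
    also have "\<dots> \<le> (\<Sum>i=1..k. ((\<Sum>l=i..k. n l) + m)\<^sup>2)"
      using k by (intro member_le_sum[of 1]) auto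
    finally have e: "(\<Sum>i=1..k. n i) \<le> (\<Sum>i=1..k. ((\<Sum>l=i..k. n l) + m)\<^sup>2)" .
    have "norm (chain_weight k m q n) = norm q ^ (\<Sum>i=1..k. ((\<Sum>l=i..k. n l) + m)\<^sup>2) *
      ((\<Prod>i=1..k. norm (inverse (qpoch q q (n i)))) * norm (inverse (qpoch q q (n k + 2 * m))))"
      by (simp add: chain_weight_def norm_mult norm_divide norm_power norm_inverse divide_inverse
            prod_inversef[unfolded o_def, symmetric] prod_norm[symmetric])
    also have "\<dots> \<le> norm q ^ (\<Sum>i=1..k. n i) * ((\<Prod>i=1..k. K) * K)"
      using q K e by (intro mult_mono power_decreasing prod_mono mult_nonneg_nonneg prod_nonneg conjI) auto
    finally show ?thesis by (simp add: power_sum)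
  qed
  have "(\<lambda>n. (\<Prod>i\<in>{1..k}. norm q ^ n i) * (K ^ k * K)) summable_on (PiE {1..k} (\<lambda>_. UNIV))"
    by (intro summable_on_cmult_left summable_on_geometric_PiE) (use q in auto)
  then have "(\<lambda>n. norm (chain_weight k m q n)) summable_on (PiE {1..k} (\<lambda>_. UNIV))"
    by (rule summable_on_comparison_test) (use bound in auto)
  then show ?thesis by (rule abs_summable_summable)
qed

text \<open>
  Distributing the last variable \<open>n\<^sub>k\<close> over two variables leaves all partial sums
  \<open>n\<^sub>i + \<dots> + n\<^sub>k\<close> with \<open>i \<le> k\<close> unchanged and adds one more, namely \<open>l\<close>.
\<close>
lemma sum_squares_split_last:
  fixes n :: "nat \<Rightarrow> nat"
  assumes k: "k \<ge> 1" and l: "l \<le> n k" and n': "n' = n(k := n k - l, Suc k := l)"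
  shows "(\<Sum>i=1..Suc k. ((\<Sum>l=i..Suc k. n' l) + m)\<^sup>2) 
    = (\<Sum>i=1..k. ((\<Sum>l=i..k. n l) + m)\<^sup>2) + (l + m)\<^sup>2"
proof -
  have "(\<Sum>l=i..Suc k. n' l) = (\<Sum>l=i..k. n l)" if "i \<in> {1..k}" for i
  proof -
    have "(\<Sum>l=i..Suc k. n' l) = (\<Sum>l=i..k. n' l) + l" using that by (simp add: n')
    also have "(\<Sum>l=i..k. n' l) = n' k + (\<Sum>l\<in>{i..k} - {k}. n' l)"
      using that by (intro sum.remove) auto
    also have "(\<Sum>l\<in>{i..k} - {k}. n' l) = (\<Sum>l\<in>{i..k} - {k}. n l)"
      by (intro sum.cong) (auto simp: n')
    also have "n' k + (\<Sum>l\<in>{i..k} - {k}. n l) + l = n k + (\<Sum>l\<in>{i..k} - {k}. n l)"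
      using l by (simp add: n')
    also have "\<dots> = (\<Sum>l=i..k. n l)"
      using that by (intro sum.remove[symmetric]) auto
    finally show ?thesis .
  qed
  then show ?thesis by (simp add: n')
qed

lemma chain_weight_split_last:
  fixes q :: complex
  assumes q: "norm q < 1" and k: "k \<ge> 1"
  shows "(\<Sum>l\<le>n k. chain_weight (Suc k) m q (n(k := n k - l, Suc k := l))) = q ^ m\<^sup>2 * chain_weight k m q n"
proof -
  define P where "P = (\<Prod>i\<in>{1..k} - {k}. qpoch q q (n i))"
  define E where "E = (\<Sum>i=1..k. ((\<Sum>l=i..k. n l) + m)\<^sup>2)"
  have summand: "chain_weight (Suc k) m q (n(k := n k - l, Suc k := l)) = q ^ E / P * q ^ m\<^sup>2 *
     (q ^ (l * (l + 2 * m)) / (qpoch q q (n k - l) * qpoch q q l * qpoch q q (l + 2 * m)))"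
    if "l \<le> n k" for l
  proof -
    define n' where "n' = n(k := n k - l, Suc k := l)"
    have "(\<Prod>i=1..k. qpoch q q (n' i)) = qpoch q q (n' k) * (\<Prod>i\<in>{1..k} - {k}. qpoch q q (n' i))"
      using k by (intro prod.remove) auto
    also have "(\<Prod>i\<in>{1..k} - {k}. qpoch q q (n' i)) = P"
      unfolding P_def by (intro prod.cong) (auto simp: n'_def)
    finally have prod: "(\<Prod>i=1..Suc k. qpoch q q (n' i)) = qpoch q q (n k - l) * P * qpoch q q l"
      by (simp add: n'_def)
    have "(l + m)\<^sup>2 = l * (l + 2 * m) + m\<^sup>2" by (simp add: power2_eq_square algebra_simps)
    then have "q ^ (\<Sum>i=1..Suc k. ((\<Sum>l=i..Suc k. n' l) + m)\<^sup>2) = q ^ E * q ^ m\<^sup>2 * q ^ (l * (l + 2 * m))"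
      unfolding sum_squares_split_last[where n = n, OF k that n'_def] E_def by (simp add: power_add)
    moreover have "n' (Suc k) = l" by (simp add: n'_def)
    ultimately show ?thesis
      unfolding chain_weight_def n'_def[symmetric] prod by (simp add: mult_ac)
  qed
  have "(\<Sum>l\<le>n k. chain_weight (Suc k) m q (n(k := n k - l, Suc k := l))) = q ^ E / P * q ^ m\<^sup>2 *
     (\<Sum>l\<le>n k. q ^ (l * (l + 2 * m)) / (qpoch q q (n k - l) * qpoch q q l * qpoch q q (l + 2 * m)))"
    unfolding sum_distrib_left by (intro sum.cong refl summand) auto
  also have "\<dots> = q ^ E / P * q ^ m\<^sup>2 * (1 / (qpoch q q (n k) * qpoch q q (n k + 2 * m)))"
    by (subst q_Vandermonde_Durfee[OF power_neq_1[OF q]]) simp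
  also have "\<dots> = q ^ m\<^sup>2 * chain_weight k m q n"
  proof -
    have "(\<Prod>i=1..k. qpoch q q (n i)) = qpoch q q (n k) * P"
      unfolding P_def using k by (intro prod.remove) auto
    then show ?thesis by (simp add: chain_weight_def E_def mult_ac)
  qed
  finally show ?thesis .
qed

text \<open>
  The Bailey chain: a sum over \<open>k + 1\<close> variables is reduced to one over \<open>k\<close> variables by grouping
  the tuples that agree in \<open>n\<^sub>1, \<dots>, n\<^bsub>k-1\<^esub>\<close> and in \<open>n\<^sub>k + n\<^bsub>k+1\<^esub>\<close> and summing each finite group. Each step
  contributes a factor \<open>q\<close> to the power \<open>m\<^sup>2\<close>, and so does the Durfee series, which is the case \<open>k = 1\<close>.
\<close>
proposition chain_weight_has_sum:
  fixes q :: complex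
  assumes q: "norm q < 1" and k: "k \<ge> 1"
  shows "(chain_weight k m q has_sum q ^ (k * m\<^sup>2) / qpoch_inf q q) (PiE {1..k} (\<lambda>_. UNIV))"
  using k
proof (induction k rule: dec_induct)
  case base
  have "((\<lambda>l. q ^ m\<^sup>2 * (q ^ (l * (l + 2 * m)) / (qpoch q q l * qpoch q q (l + 2 * m)))) has_sum
      q ^ m\<^sup>2 * (1 / qpoch_inf q q)) UNIV"
    by (intro has_sum_cmult_right qpoch_inf_Durfee q)
  also have "?this \<longleftrightarrow> ?case"
  proof (rule has_sum_reindex_bij_witness[where i = "\<lambda>n. n 1" and j = "\<lambda>l. \<lambda>i\<in>{1..1}. l"])
    fix l
    have "(l + m)\<^sup>2 = m\<^sup>2 + l * (l + 2 * m)" by (simp add: power2_eq_square algebra_simps)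
    then show "chain_weight 1 m q (\<lambda>i\<in>{1..1}. l) =
       q ^ m\<^sup>2 * (q ^ (l * (l + 2 * m)) / (qpoch q q l * qpoch q q (l + 2 * m)))"
      by (simp add: chain_weight_def power_add)
  qed (auto simp: fun_eq_iff PiE_def extensional_def)
  finally show ?case .
next
  case (step k)
  let ?A = "PiE {1..k} (\<lambda>_. UNIV :: nat set)"
  \<comment> \<open>\<open>g\<close> splits the last variable, \<open>h\<close> merges the last two\<close>
  define g where "g = (\<lambda>(n::nat\<Rightarrow>nat, l). n(k := n k - l, Suc k := l))"
  define h where "h = (\<lambda>n::nat\<Rightarrow>nat. (restrict (n(k := n k + n (Suc k))) {1..k}, n (Suc k)))"
  have reindex: "((\<lambda>x. chain_weight (Suc k) m q (g x)) has_sum S) (Sigma ?A (\<lambda>n. {..n k}))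
     = (chain_weight (Suc k) m q has_sum S) (PiE {1..Suc k} (\<lambda>_. UNIV))" for S
  proof (rule has_sum_reindex_bij_witness[where i = h and j = g])
    show "h (g x) = x" if "x \<in> Sigma ?A (\<lambda>n. {..n k})" for x
      using that step.hyps by (auto simp: h_def g_def fun_eq_iff PiE_def extensional_def restrict_def)
    show "g x \<in> PiE {1..Suc k} (\<lambda>_. UNIV)" if "x \<in> Sigma ?A (\<lambda>n. {..n k})" for x
      using that step.hyps by (auto simp: g_def PiE_def extensional_def)
    show "g (h n) = n" if "n \<in> PiE {1..Suc k} (\<lambda>_. UNIV)" for n
      using that step.hyps by (auto simp: h_def g_def fun_eq_iff PiE_def extensional_def restrict_def)
    show "h n \<in> Sigma ?A (\<lambda>n. {..n k})" if "n \<in> PiE {1..Suc k} (\<lambda>_. UNIV)" for n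
      using that step.hyps by (auto simp: h_def)
  qed auto
  have "((\<lambda>x. chain_weight (Suc k) m q (g x)) has_sum q ^ m\<^sup>2 * (q ^ (k * m\<^sup>2) / qpoch_inf q q))
     (Sigma ?A (\<lambda>n. {..n k}))"
  proof (rule has_sum_SigmaI)
    show "((\<lambda>l. chain_weight (Suc k) m q (g (n, l))) has_sum q ^ m\<^sup>2 * chain_weight k m q n) {..n k}" for n
      using chain_weight_split_last[OF q, where k = k and n = n and m = m] step.hyps by (intro has_sum_finiteI) (auto simp: g_def)
    show "((\<lambda>n. q ^ m\<^sup>2 * chain_weight k m q n) has_sum q ^ m\<^sup>2 * (q ^ (k * m\<^sup>2) / qpoch_inf q q)) ?A"
      by (intro has_sum_cmult_right step.IH)
    show "(\<lambda>x. chain_weight (Suc k) m q (g x)) summable_on Sigma ?A (\<lambda>n. {..n k})"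
      unfolding summable_on_def reindex
      using chain_weight_summable[OF q, of "Suc k" m] by (simp add: summable_on_def)
  qed
  then show ?case
    unfolding reindex by (simp add: power_add)
qed

lemma two_choose_2: "2 * int (r choose 2) = int r ^ 2 - int r"
  by (induction r) (simp_all add: Suc_choose_2 power2_eq_square algebra_simps)

text \<open>
  Since \<open>(3 r\<^sup>2 - 5 r) / 2 = 3 r (r - 1) / 2 - r\<close>, adding \<open>r + j\<close> turns the exponent into a
  multiple of 3, so that apart from \<open>q\<^bsup>-(r+j)\<^esup>\<close> only powers of \<open>q\<^sup>3\<close> occur.
\<close>
lemma qexponent_eq:
  assumes "k \<ge> 1"
  shows "qexponent k n r j + (r + j) = 3 * (\<Sum>i=1..k. ((\<Sum>l=i..k. n l) + (r + j))\<^sup>2) + 3 * (r choose 2)"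
proof -
  have "3 * (int r)\<^sup>2 - 5 * int r = 2 * (3 * int (r choose 2) - int r)"
    using two_choose_2[of r] by simp
  then have "(3 * (int r)\<^sup>2 - 5 * int r) div 2 = 3 * int (r choose 2) - int r"
    by simp
  then have "int (qexponent k n r j + (r + j)) 
      = int (3 * (\<Sum>i=1..k. ((\<Sum>l=i..k. n l) + (r + j))\<^sup>2) + 3 * (r choose 2))"
    using qexponent_int_nonneg[OF assms, of n r j]
    by (simp add: qexponent_def qexponent_int_def Mpart_def add.assoc)
  then show ?thesis by (simp only: of_nat_eq_iff)
qed

text \<open>
  A linear lower bound on the exponent, which yields both domination by a product of geometric series
  and the finiteness of the number of terms of any given degree.
\<close>
lemma qexponent_ge:
  assumes "k \<ge> 1"
  shows "(\<Sum>i=1..k. n i) + r + j \<le> qexponent k n r j"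
proof -
  have "(\<Sum>i=1..k. n i) + (r + j) \<le> ((\<Sum>i=1..k. n i) + (r + j))\<^sup>2" by (rule power2_nat_le_imp_le) simp
  also have "\<dots> \<le> (\<Sum>i=1..k. ((\<Sum>l=i..k. n l) + (r + j))\<^sup>2)"
    using assms by (intro member_le_sum[of 1]) auto
  finally show ?thesis using qexponent_eq[OF assms, of n r j] by linarith
qed

section \<open>The identity for nonzero complex q\<close>

definition tuples :: "nat \<Rightarrow> ((nat \<Rightarrow> nat) \<times> nat \<times> nat) set" where
  "tuples k = PiE {1..k} (\<lambda>_. UNIV) \<times> UNIV"

lemma tuples_eq: "tuples k = insert (\<lambda>i\<in>{1..k}. 0, 0, 0) (nonzero_tuples k)"
proof (intro equalityI subsetI)
  fix t assume "t \<in> tuples k"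
  then obtain n r j where t: "t = (n, r, j)" and n: "n \<in> PiE {1..k} (\<lambda>_. UNIV)"
    by (auto simp: tuples_def)
  show "t \<in> insert (\<lambda>i\<in>{1..k}. 0, 0, 0) (nonzero_tuples k)"
  proof (cases "(\<forall>i\<in>{1..k}. n i = 0) \<and> r = 0 \<and> j = 0")
    case True
    then have "n = (\<lambda>i\<in>{1..k}. 0)"
      using n by (auto simp: fun_eq_iff PiE_def extensional_def restrict_def)
    with True show ?thesis by (simp add: t)
  qed (use n in \<open>auto simp: t nonzero_tuples_def\<close>)
qed (auto simp: tuples_def nonzero_tuples_def)

lemma zero_tuple_notin: "(\<lambda>i\<in>{1..k}. 0, 0, 0) \<notin> nonzero_tuples k"
  by (simp add: nonzero_tuples_def)

lemma qsummand_zero_tuple: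
  fixes q :: complex
  assumes "k \<ge> 1"
  shows "qsummand k q (\<lambda>i\<in>{1..k}. 0, 0, 0) = 1"
proof -
  have "qexponent k (\<lambda>i\<in>{1..k}. 0) 0 0 = 0"
    using qexponent_eq[OF assms, of "\<lambda>i\<in>{1..k}. 0" 0 0] by simp
  then show ?thesis
    using assms by (simp add: qsummand_def qpoch_minus_1)
qed

definition weight_bound :: "nat \<Rightarrow> real \<Rightarrow> (nat \<Rightarrow> nat) \<times> nat \<times> nat \<Rightarrow> real" where
  "weight_bound k \<rho> = (\<lambda>(n, r, j). (\<Prod>i\<in>{1..k}. \<rho> ^ n i) * (\<rho> ^ r * \<rho> ^ j))"

lemma weight_bound_summable:
  assumes "0 \<le> \<rho>" "\<rho> < 1"
  shows "weight_bound k \<rho> summable_on tuples k"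
proof -
  have geo: "(\<lambda>r. \<rho> ^ r) summable_on UNIV"
    using assms by (intro norm_summable_imp_summable_on) (simp add: summable_geometric)
  have "(\<lambda>(r, j). \<rho> ^ r * \<rho> ^ j) summable_on UNIV \<times> UNIV"
    using assms by (intro summable_on_times_nonneg geo) auto
  then have "(\<lambda>(n, y). (\<Prod>i\<in>{1..k}. \<rho> ^ n i) * (case y of (r, j) \<Rightarrow> \<rho> ^ r * \<rho> ^ j)) summable_on tuples k"
    unfolding tuples_def UNIV_Times_UNIV using assms
    by (intro summable_on_times_nonneg summable_on_geometric_PiE) (auto intro: prod_nonneg)
  then show ?thesis by (simp add: weight_bound_def case_prod_unfold)
qed

text \<open>
  The factors of the summand other than the power of \<open>q\<close> are bounded uniformly on the disc of
  radius \<open>\<rho>\<close> and in the tuple, because all shifted factorials and their inverses are.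
\<close>
lemma qsummand_bound:
  fixes \<rho> :: real
  assumes \<rho>: "0 \<le> \<rho>" "\<rho> < 1" and k: "k \<ge> 1"
  obtains C where "C \<ge> 0" "\<And>(q::complex) t. norm q \<le> \<rho> \<Longrightarrow> norm (qsummand k q t) \<le> weight_bound k \<rho> t * C"
proof -
  obtain K where K: "K \<ge> 1"
    "\<And>(a::complex) q n. norm q \<le> \<rho> \<Longrightarrow> norm a \<le> 1 \<Longrightarrow> norm (qpoch a q n) \<le> K"
    "\<And>(a::complex) q n. norm q \<le> \<rho> \<Longrightarrow> norm a \<le> \<rho> \<Longrightarrow> norm (inverse (qpoch a q n)) \<le> K"
    using qpoch_bounds[OF \<rho>] by blast
  define C where "C = (K * 2) * 2 * (K ^ k * K * K * K * K)"
  show thesis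
  proof (rule that[of C])
    show "C \<ge> 0" using K by (simp add: C_def)
    fix q :: complex and t :: "(nat \<Rightarrow> nat) \<times> nat \<times> nat"
    assume q: "norm q \<le> \<rho>"
    obtain n r j where t: "t = (n, r, j)" by (metis prod_cases3)
    have q1: "norm q \<le> 1" using q \<rho> by simp
    have "norm q ^ 3 \<le> norm q ^ 1" using q1 by (intro power_decreasing) auto
    then have Q: "norm (q ^ 3) \<le> \<rho>" "norm (- (q ^ 3)) \<le> \<rho>" "norm (q ^ 3) \<le> 1"
      using q \<rho> by (auto simp: norm_power)
    have pow1: "norm (q ^ i) \<le> 1" for i using q1 by (simp add: norm_power power_le_one)
    have exponent: "norm (q ^ qexponent k n r j) \<le> weight_bound k \<rho> t"
    proof -
      have "norm (q ^ qexponent k n r j) \<le> norm q ^ ((\<Sum>i=1..k. n i) + r + j)"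
        unfolding norm_power using q1 by (intro power_decreasing qexponent_ge k) auto
      also have "\<dots> \<le> \<rho> ^ ((\<Sum>i=1..k. n i) + r + j)"
        using q by (intro power_mono) auto
      finally show ?thesis
        by (simp add: t weight_bound_def power_add power_sum mult.assoc)
    qed
    have num: "norm (if r = 0 \<and> j = 0 then 1 else qpoch (q ^ 3) (q ^ 3) (2 * j + r - 1) 
        * (1 - q ^ (6 * r + 6 * j))) \<le> K * 2"
    proof (cases "r = 0 \<and> j = 0")
      case False
      have "norm (1 - q ^ (6 * r + 6 * j)) \<le> 2"
        using norm_triangle_ineq4[of 1 "q ^ (6 * r + 6 * j)"] pow1[of "6 * r + 6 * j"] by simp
      then have "norm (qpoch (q ^ 3) (q ^ 3) (2 * j + r - 1)) * norm (1 - q ^ (6 * r + 6 * j)) \<le> K * 2"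
        using K(1) by (intro mult_mono K(2) Q) auto
      then show ?thesis using False K(1) by (simp add: norm_mult)
    qed (use K in auto)
    have num2: "norm (1 + q ^ (2 * r + 2 * j)) \<le> 2"
      using norm_triangle_ineq[of 1 "q ^ (2 * r + 2 * j)"] pow1[of "2 * r + 2 * j"] by simp
    have neg: "norm (inverse (qpoch (- 1) (q ^ 3) (j + 1))) \<le> K"
    proof -
      have "norm (inverse (qpoch (- 1) (q ^ 3) (j + 1))) = norm (inverse (qpoch (- (q ^ 3)) (q ^ 3) j)) / 2"
        by (simp only: Suc_eq_plus1[symmetric] qpoch_minus_1 inverse_mult_distrib norm_mult) simp
      also have "\<dots> \<le> K / 2" using K(3)[OF Q(1,2), of j] by simp
      finally show ?thesis using K(1) by simp
    qed
    note inv = K(3)[OF Q(1,1)]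
    have "norm (qsummand k q t) = norm (q ^ qexponent k n r j) * (norm (if r = 0 \<and> j = 0 then 1 else
         qpoch (q ^ 3) (q ^ 3) (2 * j + r - 1) * (1 - q ^ (6 * r + 6 * j))) * norm (1 + q ^ (2 * r + 2 * j)) *
       ((\<Prod>i=1..k. norm (inverse (qpoch (q ^ 3) (q ^ 3) (n i))))
        * norm (inverse (qpoch (q ^ 3) (q ^ 3) r)) * norm (inverse (qpoch (q ^ 3) (q ^ 3) j))
        * norm (inverse (qpoch (- 1) (q ^ 3) (j + 1)))
        * norm (inverse (qpoch (q ^ 3) (q ^ 3) (n k + 2 * r + 2 * j)))))"
      by (simp only: t qsummand_def prod.case norm_mult norm_divide norm_inverse divide_inverse
            prod_inversef[unfolded o_def, symmetric] prod_norm[symmetric] inverse_mult_distrib mult.assoc)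
    also have "\<dots> \<le> weight_bound k \<rho> t * ((K * 2) * 2 * ((\<Prod>i=1..k. K) * K * K * K * K))"
      using K(1) \<rho> order.trans[OF norm_ge_zero exponent]
      by (intro mult_mono exponent num num2 neg inv prod_mono mult_nonneg_nonneg prod_nonneg conjI ballI) auto
    finally show "norm (qsummand k q t) \<le> weight_bound k \<rho> t * C"
      by (simp add: C_def)
  qed
qed

lemma qsummand_summable_on_tuples:
  fixes q :: complex
  assumes "norm q < 1" and "k \<ge> 1"
  shows "qsummand k q summable_on tuples k"
proof -
  obtain C where C: "C \<ge> 0"
     "\<And>(p::complex) t. norm p \<le> norm q \<Longrightarrow> norm (qsummand k p t) \<le> weight_bound k (norm q) t * C"
    using qsummand_bound[OF norm_ge_zero assms] by blast
  have "(\<lambda>t. norm (qsummand k q t)) summable_on tuples k"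
    by (rule summable_on_comparison_test[OF summable_on_cmult_left[OF weight_bound_summable, of "norm q" k C]])
       (use assms C in auto)
  then show ?thesis by (rule abs_summable_summable)
qed

text \<open>
  The part of the summand that does not involve \<open>n\<^sub>1, \<dots>, n\<^sub>k\<close>. The negative exponent
  \<open>- (r + j)\<close> is the reason for treating \<open>q \<noteq> 0\<close> first.
\<close>
definition outer_weight :: "complex \<Rightarrow> nat \<Rightarrow> nat \<Rightarrow> complex" where
  "outer_weight q r j = (q ^ 3) ^ (r choose 2) / q ^ (r + j)
     * (if r = 0 \<and> j = 0 then 1
        else qpoch (q ^ 3) (q ^ 3) (2 * j + r - 1) * (1 - q ^ (6 * (r + j))))
     * (1 + q ^ (2 * (r + j)))
     / (qpoch (q ^ 3) (q ^ 3) r * qpoch (q ^ 3) (q ^ 3) j * qpoch (- 1) (q ^ 3) (j + 1))"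

lemma qsummand_factor:
  assumes "q \<noteq> 0" and "k \<ge> 1"
  shows "qsummand k q (n, r, j) = outer_weight q r j * chain_weight k (r + j) (q ^ 3) n"
proof -
  define M where "M = (\<Sum>i=1..k. ((\<Sum>l=i..k. n l) + (r + j))\<^sup>2)"
  have "q ^ qexponent k n r j * q ^ (r + j) = (q ^ 3) ^ M * (q ^ 3) ^ (r choose 2)"
    using qexponent_eq[OF assms(2), of n r j] unfolding M_def by (simp only: power_add[symmetric] power_mult[symmetric])
  then have "q ^ qexponent k n r j = (q ^ 3) ^ M * (q ^ 3) ^ (r choose 2) / q ^ (r + j)"
    using assms(1) by (simp add: eq_divide_eq)
  then show ?thesis
    unfolding qsummand_def outer_weight_def chain_weight_def M_def[symmetric] prod.case
    by (simp add: mult_ac distrib_left add.assoc)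
qed

text \<open>
  For fixed \<open>m = r + j > 0\<close> the factors \<open>1 + q\<^bsup>2m\<^esup>\<close>, \<open>1 - q\<^bsup>6m\<^esup>\<close> and \<open>q\<^bsup>-m\<^esup>\<close> are constant, and
  \<open>q_Vandermonde_half\<close> evaluates the remaining sum as \<open>1 / (1 - q\<^bsup>6m\<^esup>)\<close>. What is
  left is \<open>q\<^bsup>-m\<^esup> (1 + q\<^bsup>2m\<^esup>)\<close>.
\<close>
lemma outer_weight_sum:
  fixes q :: complex
  assumes q: "norm q < 1" and q0: "q \<noteq> 0"
  shows "(\<Sum>j\<le>m. outer_weight q (m - j) j) = (if m = 0 then 1 else q ^ m + 1 / q ^ m)"
proof (cases m)
  case (Suc p)
  have Q: "norm (q ^ 3) < 1" using q by (simp add: norm_power power_less_one_iff)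
  have "outer_weight q (m - j) j = (1 + q ^ (2 * m)) / q ^ m * (1 - (q ^ 3) ^ (2 * m)) *
     ((q ^ 3) ^ (Suc p - j choose 2) * qpoch (q ^ 3) (q ^ 3) (p + j)
            / (qpoch (q ^ 3) (q ^ 3) (Suc p - j) * qpoch (q ^ 3) (q ^ 3) j * qpoch (- 1) (q ^ 3) (j + 1)))"
    if "j \<le> m" for j
  proof -
    have "2 * j + (m - j) - 1 = p + j" "m - j + j = m" "\<not> (m - j = 0 \<and> j = 0)"
      using that Suc by auto
    moreover have "q ^ (6 * m) = (q ^ 3) ^ (2 * m)"
      by (simp flip: power_mult)
    ultimately have "outer_weight q (m - j) j = (q ^ 3) ^ (m - j choose 2) / q ^ m
       * (qpoch (q ^ 3) (q ^ 3) (p + j) * (1 - (q ^ 3) ^ (2 * m))) * (1 + q ^ (2 * m))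
       / (qpoch (q ^ 3) (q ^ 3) (m - j) * qpoch (q ^ 3) (q ^ 3) j * qpoch (- 1) (q ^ 3) (j + 1))"
      unfolding outer_weight_def by (simp only: if_False)
    then show ?thesis
      unfolding Suc[symmetric] by (simp add: mult_ac)
  qed
  then have "(\<Sum>j\<le>m. outer_weight q (m - j) j) = (1 + q ^ (2 * m)) / q ^ m * (1 - (q ^ 3) ^ (2 * m)) *
     (\<Sum>j\<le>Suc p. (q ^ 3) ^ (Suc p - j choose 2) * qpoch (q ^ 3) (q ^ 3) (p + j)
            / (qpoch (q ^ 3) (q ^ 3) (Suc p - j) * qpoch (q ^ 3) (q ^ 3) j * qpoch (- 1) (q ^ 3) (j + 1)))"
    unfolding sum_distrib_left Suc by (intro sum.cong) auto
  also have "\<dots> = (1 + q ^ (2 * m)) / q ^ m * (1 - (q ^ 3) ^ (2 * m)) * (1 / (1 - (q ^ 3) ^ (2 * Suc p)))"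
    by (subst q_Vandermonde_half[OF power_neq_1[OF Q]]) (use q0 in auto)
  also have "\<dots> = (1 + q ^ (2 * m)) / q ^ m"
  proof -
    have "(q ^ 3) ^ (2 * m) \<noteq> 1" using power_neq_1[OF Q, of "2 * p + 1"] by (simp add: Suc)
    then show ?thesis unfolding Suc[symmetric] by simp
  qed
  also have "\<dots> = q ^ m + 1 / q ^ m"
  proof -
    have "q ^ (2 * m) = q ^ m * q ^ m" by (simp only: mult_2 power_add)
    then show ?thesis using q0 by (simp add: add_divide_distrib)
  qed
  finally show ?thesis using Suc by simp
qed (simp add: outer_weight_def qpoch_minus_1)

text \<open>
  These parameters are the ones for which the Jacobi triple product is \<open>product_side\<close> times
  \<open>qpoch_inf (q ^ 3) (q ^ 3)\<close>; up to that factor, the right-hand side is what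
  the summations over the chain and over \<open>r + j = m\<close> leave for each \<open>m\<close>.
\<close>
lemma theta_term_of_powers:
  fixes q :: complex
  assumes "q \<noteq> 0" "k \<ge> 1"
  shows "theta_term (q ^ (3 * k + 1)) (q ^ (6 * k)) m
     = (q ^ 3) ^ (k * m\<^sup>2) * (if m = 0 then 1 else q ^ m + 1 / q ^ m)"
proof -
  have "m\<^sup>2 = 2 * (m choose 2) + m"
    by (induction m) (simp_all add: Suc_choose_2 power2_eq_square)
  then have m2: "k * m\<^sup>2 = 2 * k * (m choose 2) + k * m" by (simp add: algebra_simps)
  have up: "6 * k * (m choose 2) + (3 * k + 1) * m = 3 * (k * m\<^sup>2) + m"
    unfolding m2 by (simp add: algebra_simps)
  have down: "6 * k * (Suc m choose 2) + m = 3 * (k * m\<^sup>2) + (3 * k + 1) * m"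
    unfolding m2 Suc_choose_2 by (simp add: algebra_simps)
  have "(q ^ (6 * k)) ^ (m choose 2) * (q ^ (3 * k + 1)) ^ m = (q ^ 3) ^ (k * m\<^sup>2) * q ^ m"
    using up by (simp only: power_add[symmetric] power_mult[symmetric])
  moreover have "(q ^ (6 * k)) ^ (Suc m choose 2) * q ^ m = (q ^ 3) ^ (k * m\<^sup>2) * (q ^ (3 * k + 1)) ^ m"
    using down by (simp only: power_add[symmetric] power_mult[symmetric])
  then have "(q ^ (6 * k)) ^ (Suc m choose 2) / (q ^ (3 * k + 1)) ^ m = (q ^ 3) ^ (k * m\<^sup>2) * (1 / q ^ m)"
    using assms(1) by (simp add: divide_eq_eq eq_divide_eq del: power_Suc)
  ultimately show ?thesis
    by (simp only: theta_term_def distrib_left if_distrib[of "\<lambda>x. _ * x"]) auto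
qed

text \<open>
  By absolute convergence the sum may be taken first over \<open>n\<^sub>1, \<dots>, n\<^sub>k\<close>, then over the pairs
  \<open>(r, j)\<close> with \<open>r + j = m\<close>, and finally over \<open>m\<close>.
\<close>
lemma qsummand_has_sum_product_side:
  fixes q :: complex
  assumes q: "norm q < 1" and q0: "q \<noteq> 0" and k: "k \<ge> 1"
  shows "(qsummand k q has_sum product_side k q) (tuples k)"
proof -
  define S where "S = infsum (qsummand k q) (tuples k)"
  define P where "P = qpoch_inf (q ^ 3) (q ^ 3)"
  define g where "g = (\<lambda>m. (q ^ 3) ^ (k * m\<^sup>2) / P)"
  have small: "norm (q ^ d) < 1" if "d \<ge> 1" for d
    using q that by (simp add: norm_power power_less_one_iff)
  have S: "(qsummand k q has_sum S) (tuples k)"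
    unfolding S_def by (intro has_sum_infsum qsummand_summable_on_tuples q k)
  then have "((\<lambda>(y, n). qsummand k q (n, y)) has_sum S) (UNIV \<times> PiE {1..k} (\<lambda>_. UNIV))"
    unfolding tuples_def by (subst (asm) has_sum_swap) 
  then have "((\<lambda>(r, j). outer_weight q r j * g (r + j)) has_sum S) UNIV"
  proof (rule has_sum_SigmaD)
    fix y :: "nat \<times> nat"
    obtain r j where y: "y = (r, j)" by fastforce
    show "((\<lambda>n. case (y, n) of (y, n) \<Rightarrow> qsummand k q (n, y)) has_sum (case y of (r, j) \<Rightarrow> outer_weight q r j * g (r + j)))
        (PiE {1..k} (\<lambda>_. UNIV))"
      unfolding y prod.case qsummand_factor[OF q0 k] g_def P_def
      by (intro has_sum_cmult_right chain_weight_has_sum k) (use small in auto)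
  qed
  also have "?this \<longleftrightarrow> ((\<lambda>(m, j). outer_weight q (m - j) j * g m) has_sum S) (SIGMA m:UNIV. {..m})"
    by (rule has_sum_reindex_bij_witness[where i = "\<lambda>(m, j). (m - j, j)" and j = "\<lambda>(r, j). (r + j, j)"]) auto
  finally have "((\<lambda>m. (\<Sum>j\<le>m. outer_weight q (m - j) j) * g m) has_sum S) UNIV"
    by (rule has_sum_SigmaD) (auto intro!: has_sum_finiteI simp: sum_distrib_right)
  moreover have "(\<Sum>j\<le>m. outer_weight q (m - j) j) * g m = theta_term (q ^ (3 * k + 1)) (q ^ (6 * k)) m / P" for m
    unfolding outer_weight_sum[OF q q0] theta_term_of_powers[OF q0 k] g_def by (simp add: mult.commute)
  ultimately have "((\<lambda>m. theta_term (q ^ (3 * k + 1)) (q ^ (6 * k)) m / P) has_sum S) UNIV"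
    by (simp only:)
  moreover have "((\<lambda>m. theta_term (q ^ (3 * k + 1)) (q ^ (6 * k)) m / P) has_sum product_side k q) UNIV"
  proof -
    have "3 * k - 1 + (3 * k + 1) = 6 * k" using k by simp
    then have "q ^ (6 * k) = q ^ (3 * k - 1) * q ^ (3 * k + 1)"
      by (simp only: power_add[symmetric])
    then have "q ^ (6 * k) / q ^ (3 * k + 1) = q ^ (3 * k - 1)"
      using q0 by simp
    then show ?thesis
      using has_sum_divide_const[OF Jacobi_triple_product[of "q ^ (6 * k)" "q ^ (3 * k + 1)"], of P] small[of "6 * k"] q0 k
      by (simp add: product_side_def P_def mult_ac)
  qed
  ultimately have "S = product_side k q"
    by (rule has_sum_unique)
  with S show ?thesis by simp
qed

section \<open>Analyticity and passage to formal power series\<close>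

lemma qpoch_cube_nonzero:
  fixes q :: complex
  assumes "norm q < 1"
  shows "qpoch (q ^ 3) (q ^ 3) n \<noteq> 0" "qpoch (- 1) (q ^ 3) (Suc n) \<noteq> 0"
proof -
  have Q: "norm (q ^ 3) < 1" using assms by (simp add: norm_power power_less_one_iff)
  show "qpoch (q ^ 3) (q ^ 3) n \<noteq> 0"
    using power_neq_1[OF Q] by (intro qpoch_nonzero) simp
  have "- (q ^ 3) * (q ^ 3) ^ i \<noteq> 1" for i
  proof
    assume "- (q ^ 3) * (q ^ 3) ^ i = 1"
    then have "norm ((q ^ 3) ^ Suc i) = 1" by (metis norm_minus_cancel norm_one mult_minus_left power_Suc)
    moreover have "norm (q ^ 3) ^ Suc i \<le> norm (q ^ 3) ^ 1"
      using Q by (intro power_decreasing) auto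
    ultimately show False using Q by (simp only: norm_power power_one_right)
  qed
  then show "qpoch (- 1) (q ^ 3) (Suc n) \<noteq> 0"
    by (simp add: qpoch_minus_1 qpoch_nonzero)
qed

lemma qsummand_holomorphic: "(\<lambda>q::complex. qsummand k q t) holomorphic_on ball 0 1"
proof -
  have "(\<lambda>q::complex. qpoch (q ^ 3) (q ^ 3) n) holomorphic_on ball 0 1"
       "(\<lambda>q::complex. qpoch (- 1) (q ^ 3) n) holomorphic_on ball 0 1" for n
    unfolding qpoch_def by (intro holomorphic_intros)+
  then show ?thesis
    unfolding qsummand_def case_prod_unfold using qpoch_cube_nonzero
    by (cases "fst (snd t) = 0 \<and> snd (snd t) = 0") (auto intro!: holomorphic_intros)
qed

lemma fps_nth_0_qpoch_cube:
  "fps_nth (qpoch (fps_X ^ 3) (fps_X ^ 3) n :: complex fps) 0 = 1"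
  "fps_nth (qpoch (- 1) (fps_X ^ 3) (Suc n) :: complex fps) 0 = 2"
proof -
  show "fps_nth (qpoch (fps_X ^ 3) (fps_X ^ 3) n :: complex fps) 0 = 1"
    by (induction n) (simp_all add: qpoch_Suc)
  show "fps_nth (qpoch (- 1) (fps_X ^ 3) (Suc n) :: complex fps) 0 = 2"
    unfolding qpoch_minus_1 by (induction n) (simp_all add: qpoch_Suc fps_numeral_nth)
qed

lemma fps_nth_0_prod: "fps_nth (\<Prod>i\<in>A. F i) 0 = (\<Prod>i\<in>A. fps_nth (F i :: 'a::comm_ring_1 fps) 0)"
  by (induction A rule: infinite_finite_induct) simp_all

lemma qsummand_has_fps_expansion: 
  "(\<lambda>q::complex. qsummand k q t) has_fps_expansion qsummand k fps_X t"
proof -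
  have qp: "(\<lambda>q::complex. qpoch (q ^ 3) (q ^ 3) l) has_fps_expansion qpoch (fps_X ^ 3) (fps_X ^ 3) l"
       "(\<lambda>q::complex. qpoch (- 1) (q ^ 3) l) has_fps_expansion qpoch (- 1) (fps_X ^ 3) l" for l
    unfolding qpoch_def by (intro fps_expansion_intros)+
  show ?thesis
    unfolding qsummand_def case_prod_unfold
    by (cases "fst (snd t) = 0 \<and> snd (snd t) = 0")
       (auto intro!: has_fps_expansion_divide' has_fps_expansion_mult has_fps_expansion_prod
          has_fps_expansion_add has_fps_expansion_diff has_fps_expansion_fps_X_power has_fps_expansion_1 qp
          simp: fps_nth_0_prod fps_nth_0_qpoch_cube simp del: power_Suc)
qed

text \<open>
  Uniform convergence on discs serves twice: it makes the sum holomorphic, and it identifies its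
  Taylor series with the sum of the formal power series.
\<close>
lemma uniform_limit_multisum:
  assumes \<rho>: "0 \<le> \<rho>" "\<rho> < 1" and k: "k \<ge> 1"
  shows "uniform_limit (cball 0 \<rho>) (\<lambda>X q::complex. \<Sum>t\<in>X. qsummand k q t)
           (\<lambda>q. \<Sum>\<^sub>\<infinity>t\<in>nonzero_tuples k. qsummand k q t) (finite_subsets_at_top (nonzero_tuples k))"
proof -
  obtain C where C: "C \<ge> 0"
     "\<And>(q::complex) t. norm q \<le> \<rho> \<Longrightarrow> norm (qsummand k q t) \<le> weight_bound k \<rho> t * C"
    using qsummand_bound[OF assms] by blast
  show ?thesis
  proof (rule Weierstrass_m_test_general)
    show "(\<lambda>t. weight_bound k \<rho> t * C) summable_on nonzero_tuples k"
      using summable_on_cmult_left[OF weight_bound_summable[OF \<rho>, of k], of C]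
      by (rule summable_on_subset) (auto simp: tuples_eq)
  qed (use C in auto)
qed

lemma multisum_holomorphic:
  assumes k: "k \<ge> 1"
  shows "(\<lambda>q::complex. \<Sum>\<^sub>\<infinity>t\<in>nonzero_tuples k. qsummand k q t) holomorphic_on ball 0 1"
proof (rule holomorphic_on_unit_ballI)
  fix \<rho> :: real assume \<rho>: "0 < \<rho>" "\<rho> < 1"
  have holo: "(\<lambda>q::complex. \<Sum>t\<in>X. qsummand k q t) holomorphic_on ball 0 1" for X
    by (intro holomorphic_intros qsummand_holomorphic)
  have sub: "cball 0 \<rho> \<subseteq> (ball 0 1 :: complex set)" "ball 0 \<rho> \<subseteq> (ball 0 1 :: complex set)"
    using \<rho> by auto
  have "\<forall>\<^sub>F X in finite_subsets_at_top (nonzero_tuples k).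
     continuous_on (cball 0 \<rho>) (\<lambda>q::complex. \<Sum>t\<in>X. qsummand k q t)
     \<and> (\<lambda>q::complex. \<Sum>t\<in>X. qsummand k q t) holomorphic_on ball 0 \<rho>"
    using holomorphic_on_imp_continuous_on[OF holomorphic_on_subset[OF holo sub(1)]]
      holomorphic_on_subset[OF holo sub(2)] by (intro always_eventually) auto
  then show "(\<lambda>q::complex. \<Sum>\<^sub>\<infinity>t\<in>nonzero_tuples k. qsummand k q t) holomorphic_on ball 0 \<rho>"
    by (rule holomorphic_uniform_limit[OF _ uniform_limit_multisum]) (use \<rho> k in auto)
qed

lemma fps_nth_qsummand_eq_0:
  assumes "l < qexponent k n r j"
  shows "fps_nth (qsummand k (fps_X :: complex fps) (n, r, j)) l = 0"
proof -
  define D :: "complex fps" where "D = (\<Prod>i=1..k. qpoch (fps_X ^ 3) (fps_X ^ 3) (n i))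
        * qpoch (fps_X ^ 3) (fps_X ^ 3) r * qpoch (fps_X ^ 3) (fps_X ^ 3) j
        * qpoch (- 1) (fps_X ^ 3) (j + 1)
        * qpoch (fps_X ^ 3) (fps_X ^ 3) (n k + 2 * r + 2 * j)"
  have "fps_nth D 0 \<noteq> 0"
    by (simp add: D_def fps_nth_0_prod fps_nth_0_qpoch_cube)
  then show ?thesis
    using assms unfolding qsummand_def prod.case D_def[symmetric]
    by (simp add: fps_divide_unit mult.assoc fps_X_power_mult_nth)
qed

lemma qsummand_fps_summable:
  assumes k: "k \<ge> 1"
  shows "qsummand k (fps_X :: complex fps) summable_on nonzero_tuples k"
proof -
  have "finite {t \<in> nonzero_tuples k. fps_nth (qsummand k (fps_X :: complex fps) t) l \<noteq> 0}" for l
  proof (rule finite_subset)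
    show "{t \<in> nonzero_tuples k. fps_nth (qsummand k (fps_X :: complex fps) t) l \<noteq> 0}
        \<subseteq> (PiE {1..k} (\<lambda>_. {..l})) \<times> {..l} \<times> {..l}"
    proof (rule subsetI)
      fix t assume *: "t \<in> {t \<in> nonzero_tuples k. fps_nth (qsummand k (fps_X :: complex fps) t) l \<noteq> 0}"
      obtain n r j where nrj: "t = (n, r, j)" by (rule prod_cases3)
      then have t: "(n, r, j) \<in> nonzero_tuples k"
        and "fps_nth (qsummand k (fps_X :: complex fps) (n, r, j)) l \<noteq> 0"
        using * by auto
      then have "qexponent k n r j \<le> l" using fps_nth_qsummand_eq_0 not_le by blast
      then have l: "(\<Sum>i=1..k. n i) + r + j \<le> l" using qexponent_ge[OF k, of n r j] by linarith
      have "n i \<le> l" if "i \<in> {1..k}" for i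
        using member_le_sum[of i "{1..k}" n] that l by auto
      then show "t \<in> (PiE {1..k} (\<lambda>_. {..l})) \<times> {..l} \<times> {..l}"
        using t l unfolding nrj by (auto simp: nonzero_tuples_def PiE_def)
    qed
  qed (intro finite_cartesian_product finite_PiE, auto)
  then show ?thesis
    unfolding summable_on_def
    by (intro exI[of _ "Abs_fps (\<lambda>l. \<Sum>t | t \<in> nonzero_tuples k \<and> 
         fps_nth (qsummand k (fps_X :: complex fps) t) l \<noteq> 0. fps_nth (qsummand k fps_X t) l)"] has_sum_fpsI) auto
qed

lemma multisum_has_fps_expansion:
  assumes k: "k \<ge> 1"
  shows "(multisum k :: complex \<Rightarrow> complex) has_fps_expansion multisum k fps_X"
proof -
  define g where "g = (\<lambda>q::complex. \<Sum>\<^sub>\<infinity>t\<in>nonzero_tuples k. qsummand k q t)"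
  define G where "G = (\<Sum>\<^sub>\<infinity>t\<in>nonzero_tuples k. qsummand k (fps_X :: complex fps) t)"
  have exp: "g has_fps_expansion fps_expansion g 0"
    unfolding g_def by (rule has_fps_expansion_fps_expansion[OF _ _ multisum_holomorphic[OF k]]) auto
  have "fps_expansion g 0 = G"
  proof (rule uniform_limit_imp_fps_expansion_eq)
    show "((\<lambda>X. \<Sum>t\<in>X. qsummand k fps_X t) \<longlongrightarrow> G) (finite_subsets_at_top (nonzero_tuples k))"
      using has_sum_infsum[OF qsummand_fps_summable[OF k]] by (simp add: has_sum_def G_def)
    show "uniform_limit (ball 0 (1/2)) (\<lambda>X q. \<Sum>t\<in>X. qsummand k q t) g (finite_subsets_at_top (nonzero_tuples k))"
      unfolding g_def by (rule uniform_limit_on_subset[OF uniform_limit_multisum[of "1/2"]]) (use k in auto)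
    show "\<forall>\<^sub>F X in finite_subsets_at_top (nonzero_tuples k).
       (\<lambda>q::complex. \<Sum>t\<in>X. qsummand k q t) has_fps_expansion (\<Sum>t\<in>X. qsummand k fps_X t)"
      by (intro always_eventually allI has_fps_expansion_sum qsummand_has_fps_expansion)
    show "\<forall>\<^sub>F X in finite_subsets_at_top (nonzero_tuples k).
       (\<lambda>q::complex. \<Sum>t\<in>X. qsummand k q t) holomorphic_on ball 0 (1/2)"
      by (intro always_eventually allI holomorphic_intros holomorphic_on_subset[OF qsummand_holomorphic]) auto
  qed (use exp in auto)
  with exp have "(\<lambda>q. 1 + g q) has_fps_expansion (1 + G)"
    by (intro has_fps_expansion_add has_fps_expansion_1) simp
  then show ?thesis by (simp add: multisum_def[abs_def] g_def G_def)
qed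

lemma product_side_has_fps_expansion:
  assumes k: "k \<ge> 1"
  shows "(product_side k :: complex \<Rightarrow> complex) has_fps_expansion product_side k fps_X"
proof -
  have "(\<lambda>q::complex. qpoch_inf (- 1 * q ^ (3 * k - 1)) (q ^ (6 * k))
          * qpoch_inf (- 1 * q ^ (3 * k + 1)) (q ^ (6 * k)) * qpoch_inf (1 * q ^ (6 * k)) (q ^ (6 * k))
          / qpoch_inf (1 * q ^ 3) (q ^ 3)) has_fps_expansion
        (qpoch_inf (fps_const (- 1) * fps_X ^ (3 * k - 1)) (fps_X ^ (6 * k))
          * qpoch_inf (fps_const (- 1) * fps_X ^ (3 * k + 1)) (fps_X ^ (6 * k))
          * qpoch_inf (fps_const 1 * fps_X ^ (6 * k)) (fps_X ^ (6 * k))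
          / qpoch_inf (fps_const 1 * fps_X ^ 3) (fps_X ^ 3))"
    using k qpoch_fps_tendsto_qpoch_inf(2)[of 3 3 1]
    by (intro has_fps_expansion_divide' has_fps_expansion_mult qpoch_inf_has_fps_expansion) auto
  then show ?thesis
    by (simp only: product_side_def[abs_def] fps_const_1_eq_1 fps_const_neg[symmetric] mult_minus1 mult_1_left mult_minus_left)
qed

lemma product_side_holomorphic:
  assumes k: "k \<ge> 1"
  shows "(product_side k :: complex \<Rightarrow> complex) holomorphic_on ball 0 1"
proof -
  have nz: "qpoch_inf (1 * q ^ 3) (q ^ 3) \<noteq> 0" if "q \<in> ball 0 1" for q :: complex
    by (rule qpoch_inf_nonzero) (use that in \<open>auto simp: norm_power power_less_one_iff\<close>)
  have "(\<lambda>q::complex. qpoch_inf (- 1 * q ^ (3 * k - 1)) (q ^ (6 * k))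
          * qpoch_inf (- 1 * q ^ (3 * k + 1)) (q ^ (6 * k)) * qpoch_inf (1 * q ^ (6 * k)) (q ^ (6 * k))
          / qpoch_inf (1 * q ^ 3) (q ^ 3)) holomorphic_on ball 0 1"
    by (intro holomorphic_intros qpoch_inf_holomorphic nz) (use k in auto)
  then show ?thesis
    by (simp only: product_side_def[abs_def] mult_minus1 mult_1_left)
qed

text \<open>
  The value at \<open>q = 0\<close> follows from the others, since both sides are continuous there.
\<close>
lemma multisum_eq_product_side:
  fixes q :: complex
  assumes q: "norm q < 1" and k: "k \<ge> 1"
  shows "multisum k q = product_side k q"
proof -
  have nonzero: "multisum k q = product_side k q" if q: "norm q < 1" and q0: "q \<noteq> 0" for q :: complex
  proof -
    have "qsummand k q summable_on nonzero_tuples k"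
      by (rule summable_on_subset[OF qsummand_summable_on_tuples[OF q k]]) (auto simp: tuples_eq)
    then have "infsum (qsummand k q) (tuples k) = multisum k q"
      unfolding tuples_eq multisum_def
      using infsum_insert[of "qsummand k q", OF _ zero_tuple_notin] qsummand_zero_tuple[OF k, of q] by simp
    then show ?thesis
      using infsumI[OF qsummand_has_sum_product_side[OF q q0 k]] by simp
  qed
  show ?thesis
  proof (cases "q = 0")
    case True
    have lim: "multisum k \<midarrow>0\<rightarrow> multisum k (0::complex)" "product_side k \<midarrow>0\<rightarrow> product_side k (0::complex)"
      using has_fps_expansion_imp_continuous[OF multisum_has_fps_expansion[OF k], of UNIV]
        has_fps_expansion_imp_continuous[OF product_side_has_fps_expansion[OF k], of UNIV]
      by (auto simp: continuous_within)
    have "eventually (\<lambda>q::complex. multisum k q = product_side k q) (at 0)"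
      unfolding eventually_at by (intro exI[of _ 1]) (auto intro!: nonzero)
    with lim(1) have "product_side k \<midarrow>0\<rightarrow> multisum k (0::complex)"
      by (rule Lim_transform_eventually)
    with lim(2) show ?thesis using True LIM_unique by blast
  qed (use nonzero q in blast)
qed

theorem theorem3p7:
  fixes k :: nat
  assumes "k \<ge> 1"
  shows
    "(qsummand k (fps_X :: complex fps) summable_on nonzero_tuples k
        \<and> multisum k (fps_X :: complex fps) = product_side k fps_X)
     \<and> (\<forall>q::complex. norm q < 1 \<longrightarrow>
          qsummand k q summable_on nonzero_tuples k \<and> multisum k q = product_side k q)
     \<and> (multisum k :: complex \<Rightarrow> complex) analytic_on ball 0 1
     \<and> (product_side k :: complex \<Rightarrow> complex) analytic_on ball 0 1"
proof -
  have "(product_side k :: complex \<Rightarrow> complex) has_fps_expansion multisum k fps_X"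
  proof -
    have "eventually (\<lambda>q::complex. q \<in> ball 0 1) (nhds 0)"
      by (intro eventually_nhds_in_open) auto
    then have "eventually (\<lambda>q::complex. multisum k q = product_side k q) (nhds 0)"
      by eventually_elim (use multisum_eq_product_side assms in auto)
    then show ?thesis
      using multisum_has_fps_expansion[OF assms] has_fps_expansion_cong by blast
  qed
  then have "multisum k (fps_X :: complex fps) = product_side k fps_X"
    using product_side_has_fps_expansion[OF assms] by (rule fps_expansion_unique_complex)
  moreover have "qsummand k q summable_on nonzero_tuples k" if "norm q < 1" for q :: complex
    by (rule summable_on_subset[OF qsummand_summable_on_tuples[OF that assms]]) (auto simp: tuples_eq)
  moreover have "(multisum k :: complex \<Rightarrow> complex) holomorphic_on ball 0 1"
    unfolding multisum_def[abs_def] by (intro holomorphic_intros multisum_holomorphic assms)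
  ultimately show ?thesis
    using qsummand_fps_summable[OF assms] multisum_eq_product_side[OF _ assms] product_side_holomorphic[OF assms]
    by (auto simp: analytic_on_open)
qed

end
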